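(* Let $N\ge2$, $R>0$, let $g:[0,R]\to(0,\infty)$ be smooth, and let $A,B,p,q$ be positive constants with $A\neq B$, all independent of $\epsilon$. For $\epsilon>0$ let $U_\epsilon\in C^1([0,R])\cap C^\infty((0,R))$ be the unique solution of problem (N* ) described in the context, and let $$\rho_\epsilon(r)=-\frac{R^N}{N}\Big(\frac{Ae^{pU_\epsilon(r)}}{\int_0^Rs^{N-1}e^{pU_\epsilon(s)}ds}-\frac{Be^{-qU_\epsilon(r)}}{\int_0^Rs^{N-1}e^{-qU_\epsilon(s)}ds}\Big).$$ Then $\rho_\epsilon\rightharpoonup\frac{R(B-A)}{N}\delta_R$ weakly in $C([0,R];\mathbb{R})$ as $\epsilon\downarrow0$, and: (I) If $0<A<B$: $(\epsilon U_\epsilon')^2\rightharpoonup\frac{2R(B-A)}{qNg(R)}\delta_R$ and $e^{-qU_\epsilon}-1\rightharpoonup\frac{R(B-A)}{AN}\delta_R$ weakly in $C([0,R];\mathbb{R})$, and $e^{pU_\epsilon}-1\to0$ strongly in $L^\theta((0,R))$ for every $\theta>0$. (II) If $A>B>0$: $(\epsilon U_\epsilon')^2\rightharpoonup\frac{2R(A-B)}{pNg(R)}\delta_R$ and $e^{pU_\epsilon}-1\rightharpoonup\frac{R(A-B)}{BN}\delta_R$ weakly in $C([0,R];\mathbb{R})$, and $e^{-qU_\epsilon}-1\to0$ strongly in $L^\theta((0,R))$ for every $\theta>0$. (III) For every $\widetilde\theta\in(0,2)$, $\epsilon U_\epsilon'\to0$ strongly in $L^{\widetilde\theta}((0,R))$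 as $\epsilon\downarrow0$; more precisely there is a constant $C_{\widetilde\theta}>0$ independent of $\epsilon$ such that for all sufficiently small $\epsilon>0$, $$\|\epsilon U_\epsilon'\|_{L^{\widetilde\theta}((0,R))}\le C_{\widetilde\theta}\,\epsilon^{\min\{1,\frac{2}{\widetilde\theta}-1\}}\Big(\log\frac1\epsilon\Big)^{\chi(\widetilde\theta)},$$ where $\chi(\widetilde\theta)=1$ if $\widetilde\theta\in(0,1]$ and $\chi(\widetilde\theta)=0$ if $\widetilde\theta\in(1,2)$.
   Context: Problem (N* ): for $\epsilon>0$, find $U_\epsilon\in C^1([0,R])\cap C^\infty((0,R))$ such that for $r\in(0,R)$ $$\epsilon^2 g(r)\Big[U_\epsilon''(r)+\Big(\frac{N-1}{r}+\frac{g'(r)}{g(r)}\Big)U_\epsilon'(r)\Big]=\frac{R^N}{N}\Big(\frac{Ae^{pU_\epsilon(r)}}{\int_0^R s^{N-1}e^{pU_\epsilon(s)}ds}-\frac{Be^{-qU_\epsilon(r)}}{\int_0^R s^{N-1}e^{-qU_\epsilon(s)}ds}\Big),$$ together with $\int_0^R s^{N-1}U_\epsilon(s)\,ds=0$, $U_\epsilon'(0)=0$ and $U_\epsilon'(R)=\frac{R(A-B)}{\epsilon^2Ng(R)}$; it has a unique solution. Weak convergence to a Dirac mass: for functions $f_\epsilon$ on $[0,R]$ and a constant $\mathcal{C}\neq0$, "$f_\epsilon\rightharpoonup\mathcal{C}\delta_R$ weakly in $C([0,R];\mathbb{R})$" means $\lim_{\epsilon\downarrow0}\int_0^Rh(r)f_\epsilon(r)\,dr=\mathcal{C}h(R)$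 for every continuous $h:[0,R]\to\mathbb{R}$ independent of $\epsilon$. *)

theory Defs
  imports "HOL-Analysis.Analysis"
begin

definition smooth_on :: "real set \<Rightarrow> (real \<Rightarrow> real) \<Rightarrow> bool" where
  "smooth_on S f \<longleftrightarrow> (\<exists>D :: nat \<Rightarrow> real \<Rightarrow> real. D 0 = f \<and>
     (\<forall>n. \<forall>x\<in>S. (D n has_real_derivative D (Suc n) x) (at x within S)))"

definition C1_on :: "real set \<Rightarrow> (real \<Rightarrow> real) \<Rightarrow> bool" where
  "C1_on S f \<longleftrightarrow> (\<exists>f'. (\<forall>x\<in>S. (f has_real_derivative f' x) (at x within S))
                       \<and> continuous_on S f')"

definition solves_Nstar ::
  "nat \<Rightarrow> real \<Rightarrow> (real \<Rightarrow> real) \<Rightarrow> real \<Rightarrow> real \<Rightarrow> real \<Rightarrow> real \<Rightarrow> real \<Rightarrow> (real \<Rightarrow> real) \<Rightarrow> bool"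
  where
  "solves_Nstar N R g A B p q \<epsilon> U \<longleftrightarrow>
     C1_on {0..R} U \<and> smooth_on {0<..<R} U \<and>
     (\<forall>r\<in>{0<..<R}.
        \<epsilon>\<^sup>2 * g r * (deriv (deriv U) r + ((real N - 1) / r + deriv g r / g r) * deriv U r)
        = R ^ N / real N *
          (A * exp (p * U r) / integral {0..R} (\<lambda>s. s ^ (N - 1) * exp (p * U s))
           - B * exp (- q * U r) / integral {0..R} (\<lambda>s. s ^ (N - 1) * exp (- q * U s)))) \<and>
     integral {0..R} (\<lambda>s. s ^ (N - 1) * U s) = 0 \<and>
     (U has_real_derivative 0) (at 0 within {0..R}) \<and>
     (U has_real_derivative (R * (A - B) / (\<epsilon>\<^sup>2 * real N * g R))) (at R within {0..R})"

definition weak_dirac :: "real \<Rightarrow> (real \<Rightarrow> real \<Rightarrow> real) \<Rightarrow> real \<Rightarrow> bool" where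
  "weak_dirac R f C \<longleftrightarrow> (\<forall>h. continuous_on {0..R} h \<longrightarrow>
     ((\<lambda>\<epsilon>. integral {0..R} (\<lambda>r. h r * f \<epsilon> r)) \<longlongrightarrow> C * h R) (at_right 0))"

definition Lnorm :: "real \<Rightarrow> real \<Rightarrow> (real \<Rightarrow> real) \<Rightarrow> real" where
  "Lnorm R \<theta> f = (integral {0..R} (\<lambda>r. \<bar>f r\<bar> powr \<theta>)) powr (1 / \<theta>)"

definition Lconv0 :: "real \<Rightarrow> real \<Rightarrow> (real \<Rightarrow> real \<Rightarrow> real) \<Rightarrow> bool" where
  "Lconv0 R \<theta> f \<longleftrightarrow> ((\<lambda>\<epsilon>. Lnorm R \<theta> (f \<epsilon>)) \<longlongrightarrow> 0) (at_right 0)"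

end

theory Submission
  imports Defs "HOL-Real_Asymp.Real_Asymp"
begin

text \<open>
  Replacing \<open>U\<close> by \<open>- U\<close> exchanges the two cases, so let \<open>A > B\<close>. Write \<open>e\<close> for \<open>\<epsilon>\<close>, \<open>w = U'\<close>, \<open>F = - \<rho>\<close> and
  \<open>G = e\<^sup>2 r\<^bsup>N-1\<^esup> g w\<close>, so that \<open>G' = r\<^bsup>N-1\<^esup> F\<close>. A maximum principle gives \<open>F \<ge> 0\<close> and \<open>w \<ge> 0\<close>,
  hence \<open>U\<close>, \<open>F\<close> and \<open>G\<close> are nondecreasing. The weighted mass of \<open>F\<close> is fixed, which bounds \<open>F\<close>
  inside; feeding this back through \<open>F' \<ge> p B w\<close> yields \<open>F = O(e\<^sup>2)\<close> on compact subsets of \<open>[0, R)\<close>.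
  So all the mass sits at \<open>R\<close>, and \<open>U\<close> tends to \<open>0\<close> inside because its mean vanishes
  and its exponential moment is bounded.

  With the primitive \<open>V\<close> of \<open>F w\<close>, the identity \<open>(G\<^sup>2 / (2 e\<^sup>2))' = r\<^bsup>2(N-1)\<^esup> g V'\<close> compares \<open>e\<^sup>2 w\<^sup>2\<close>
  with \<open>2 V / g\<close> near \<open>R\<close>, and \<open>V\<close> with \<open>exp (p U)\<close>. This gives the limit of the energy, the bound
  \<open>exp (p U(R)) \<le> C / e\<^sup>2\<close>, and from it the rates in \<open>L\<^sup>\<theta>\<close>.
\<close>

section \<open>Families of functions concentrating at the boundary\<close>

declare One_nat_def [simp del]

text \<open>The differential inequalities below are used in this integrated form. Derivatives are
  asked for only in the open interval, since the equation holds only in (0, R), while continuity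
  reaches the endpoints.\<close>

lemma interval_mono:
  fixes f :: "real \<Rightarrow> real"
  assumes "x \<le> y" "continuous_on {x..y} f"
    and "\<And>r. x < r \<Longrightarrow> r < y \<Longrightarrow> (f has_real_derivative f' r) (at r)"
    and "\<And>r. x < r \<Longrightarrow> r < y \<Longrightarrow> 0 \<le> f' r"
  shows "f x \<le> f y"
  using assms by (intro DERIV_nonneg_imp_increasing_open[of x y f]) blast+

text \<open>Locally uniform convergence to 0 on [0, R): the centre is included and only
  \<open>R\<close> is left free, so a boundary layer there may blow up.\<close>

definition interior_null :: "real \<Rightarrow> (real \<Rightarrow> real \<Rightarrow> real) \<Rightarrow> bool" where
  "interior_null R f \<longleftrightarrow> (\<forall>r1\<in>{0<..<R}. \<forall>\<eta>>0. \<forall>\<^sub>F e in at_right 0. \<forall>r\<in>{0..r1}. \<bar>f e r\<bar> \<le> \<eta>)"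

lemma interior_nullD:
  "interior_null R f \<Longrightarrow> 0 < r1 \<Longrightarrow> r1 < R \<Longrightarrow> 0 < \<eta> \<Longrightarrow>
    \<forall>\<^sub>F e in at_right 0. \<forall>r\<in>{0..r1}. \<bar>f e r\<bar> \<le> \<eta>"
  unfolding interior_null_def by auto

lemma integral_split_le:
  fixes f :: "real \<Rightarrow> real"
  assumes "f integrable_on {0..R}" "0 \<le> c" "c \<le> R"
    and "\<And>r. r \<in> {0..c} \<Longrightarrow> f r \<le> x" and "\<And>r. r \<in> {c..R} \<Longrightarrow> f r \<le> y"
  shows "integral {0..R} f \<le> c * x + (R - c) * y"
proof -
  have i: "f integrable_on {0..c}" "f integrable_on {c..R}"
    using assms by (auto intro: integrable_on_subinterval)
  have "integral {0..c} f \<le> integral {0..c} (\<lambda>_. x)"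
    using i assms by (intro integral_le) auto
  moreover have "integral {c..R} f \<le> integral {c..R} (\<lambda>_. y)"
    using i assms by (intro integral_le) auto
  moreover have "integral {0..c} f + integral {c..R} f = integral {0..R} f"
    using assms by (intro Henstock_Kurzweil_Integration.integral_combine) auto
  ultimately show ?thesis
    using assms by simp
qed

lemma tendsto_zero_at_right_leI:
  fixes f :: "real \<Rightarrow> real"
  assumes "\<And>\<eta>. 0 < \<eta> \<Longrightarrow> \<forall>\<^sub>F e in at_right 0. \<bar>f e\<bar> \<le> K * \<eta>"
  shows "(f \<longlongrightarrow> 0) (at_right 0)"
proof (rule tendstoI)
  fix d :: real assume d: "0 < d"
  have "0 < d / (\<bar>K\<bar> + 1)" using d by simp
  from assms[OF this] show "\<forall>\<^sub>F e in at_right 0. dist (f e) 0 < d"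
  proof eventually_elim
    case (elim e)
    have "K * d \<le> \<bar>K\<bar> * d" using d by (intro mult_right_mono) auto
    moreover have "d * (\<bar>K\<bar> + 1) = \<bar>K\<bar> * d + d" by (simp add: algebra_simps)
    ultimately have "K * d < d * (\<bar>K\<bar> + 1)" using d by linarith
    then have "K * (d / (\<bar>K\<bar> + 1)) < d" by (simp add: pos_divide_less_eq)
    then show ?case using elim by simp
  qed
qed

text \<open>On \<open>{0..c}\<close> the functions are small; the rest has length at most
  \<open>\<eta>\<close>, and there the uniform bound suffices.\<close>

lemma interior_null_integral_tendsto_0:
  assumes R: "0 < R" and f: "interior_null R f"
    and int: "\<And>e. 0 < e \<Longrightarrow> f e integrable_on {0..R}"
    and bdd: "\<forall>\<^sub>F e in at_right 0. \<forall>r\<in>{0..R}. \<bar>f e r\<bar> \<le> K"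
  shows "((\<lambda>e. integral {0..R} (f e)) \<longlongrightarrow> 0) (at_right 0)"
proof (rule tendsto_zero_at_right_leI[where K="R + \<bar>K\<bar>"])
  fix \<eta> :: real assume \<eta>: "0 < \<eta>"
  define c where "c = max (R/2) (R - \<eta>)"
  have c: "0 < c" "c < R" "R - c \<le> \<eta>" using R \<eta> by (auto simp: c_def)
  show "\<forall>\<^sub>F e in at_right 0. \<bar>integral {0..R} (f e)\<bar> \<le> (R + \<bar>K\<bar>) * \<eta>"
    using interior_nullD[OF f c(1,2) \<eta>] bdd eventually_at_right_less[of 0]
  proof eventually_elim
    case (elim e)
    have le: "f e r \<le> \<eta>" "- f e r \<le> \<eta>" if "r \<in> {0..c}" for r
      using elim(1) that by (auto simp: abs_le_iff)
    have le': "f e r \<le> \<bar>K\<bar>" "- f e r \<le> \<bar>K\<bar>" if "r \<in> {c..R}" for r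
    proof -
      have "\<bar>f e r\<bar> \<le> K" using elim(2) that c by auto
      then show "f e r \<le> \<bar>K\<bar>" "- f e r \<le> \<bar>K\<bar>" by auto
    qed
    have i: "f e integrable_on {0..R}" "(\<lambda>r. - f e r) integrable_on {0..R}"
      using int elim by (auto intro: integrable_neg)
    have "integral {0..R} (f e) \<le> c * \<eta> + (R - c) * \<bar>K\<bar>"
      by (rule integral_split_le[OF i(1)]) (use c le le' in auto)
    moreover have "integral {0..R} (\<lambda>r. - f e r) \<le> c * \<eta> + (R - c) * \<bar>K\<bar>"
      by (rule integral_split_le[OF i(2)]) (use c le le' in auto)
    moreover have "c * \<eta> \<le> R * \<eta>" "(R - c) * \<bar>K\<bar> \<le> \<eta> * \<bar>K\<bar>"
      using c \<eta> by (auto intro: mult_right_mono)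
    ultimately show ?case by (auto simp: algebra_simps)
  qed
qed

text \<open>Away from \<open>R\<close> the family is small and k - k R is bounded; near
  \<open>R\<close> the factor k - k R is small and only the mass of \<open>f\<close> counts, so
  \<open>f\<close> may blow up there. The conclusion is a difference of integrals because in some
  uses the total mass is not yet known to converge.\<close>

lemma interior_null_integral_concentrates:
  assumes R: "0 < R" and f: "interior_null R f" and k: "continuous_on {0..R} k"
    and int: "\<And>e. 0 < e \<Longrightarrow> continuous_on {0..R} (f e)"
    and nonneg: "\<And>e r. 0 < e \<Longrightarrow> r \<in> {0..R} \<Longrightarrow> 0 \<le> f e r"
    and bdd: "\<forall>\<^sub>F e in at_right 0. integral {0..R} (f e) \<le> K"
  shows "((\<lambda>e. integral {0..R} (\<lambda>r. k r * f e r) - k R * integral {0..R} (f e)) \<longlongrightarrow> 0) (at_right 0)"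
proof -
  have "continuous_on {0..R} (\<lambda>r. \<bar>k r - k R\<bar>)" using k by (intro continuous_intros)
  then have "\<exists>x\<in>{0..R}. \<forall>y\<in>{0..R}. \<bar>k y - k R\<bar> \<le> \<bar>k x - k R\<bar>"
    using R by (intro continuous_attains_sup) auto
  then obtain L where L: "\<And>r. r \<in> {0..R} \<Longrightarrow> \<bar>k r - k R\<bar> \<le> L" by blast
  have L0: "0 \<le> L" using L[of R] R by auto
  show ?thesis
  proof (rule tendsto_zero_at_right_leI[where K="K + L * R"])
    fix \<eta> :: real assume \<eta>: "0 < \<eta>"
    obtain d where d: "0 < d" "\<And>r. r \<in> {0..R} \<Longrightarrow> dist r R < d \<Longrightarrow> dist (k r) (k R) < \<eta>"
      using k \<eta> R unfolding continuous_on_iff by (metis atLeastAtMost_iff less_eq_real_def)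
    define c where "c = max (R/2) (R - d/2)"
    have c: "0 < c" "c < R" "R - c < d" using R d(1) by (auto simp: c_def)
    have near: "\<bar>k r - k R\<bar> \<le> \<eta>" if "r \<in> {c..R}" for r
      using d(2)[of r] that c by (auto simp: dist_real_def)
    show "\<forall>\<^sub>F e in at_right 0. \<bar>integral {0..R} (\<lambda>r. k r * f e r) - k R * integral {0..R} (f e)\<bar> \<le> (K + L * R) * \<eta>"
      using interior_nullD[OF f c(1,2) \<eta>] bdd eventually_at_right_less[of 0]
    proof eventually_elim
      case (elim e)
      have fc: "continuous_on {0..R} (f e)" using int elim by simp
      have i: "f e integrable_on {0..R}" by (intro integrable_continuous_real fc)
      have eq: "integral {0..R} (\<lambda>r. k r * f e r) - k R * integral {0..R} (f e)
        = integral {0..R} (\<lambda>r. (k r - k R) * f e r)"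
      proof -
        have "integral {0..R} (\<lambda>r. (k r - k R) * f e r)
          = integral {0..R} (\<lambda>r. k r * f e r - k R * f e r)" by (simp add: algebra_simps)
        also have "\<dots> = integral {0..R} (\<lambda>r. k r * f e r) - integral {0..R} (\<lambda>r. k R * f e r)"
          by (intro integral_diff integrable_continuous_real continuous_intros fc k)
        finally show ?thesis by simp
      qed
      have pt: "\<bar>(k r - k R) * f e r\<bar> \<le> \<eta> * f e r + L * \<eta>" if r: "r \<in> {0..R}" for r
      proof (cases "r \<le> c")
        case True
        then have "\<bar>k r - k R\<bar> * \<bar>f e r\<bar> \<le> L * \<eta>"
          using L[OF r] elim r L0 by (intro mult_mono) auto
        moreover have "0 \<le> \<eta> * f e r" using nonneg[of e r] elim r \<eta> by auto
        ultimately show ?thesis by (simp add: abs_mult)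
      next
        case False
        then have "\<bar>k r - k R\<bar> * \<bar>f e r\<bar> \<le> \<eta> * f e r"
          using near[of r] nonneg[of e r] elim r by (auto intro: mult_right_mono)
        moreover have "0 \<le> L * \<eta>" using L0 \<eta> by auto
        ultimately show ?thesis by (simp add: abs_mult)
      qed
      have "\<bar>integral {0..R} (\<lambda>r. (k r - k R) * f e r)\<bar> \<le> integral {0..R} (\<lambda>r. \<eta> * f e r + L * \<eta>)"
        using pt by (subst real_norm_def[symmetric], intro integral_norm_bound_integral
            integrable_continuous_real continuous_intros fc k) auto
      also have "\<dots> = integral {0..R} (\<lambda>r. \<eta> * f e r) + integral {0..R} (\<lambda>r. L * \<eta>)"
        by (intro integral_add integrable_continuous_real continuous_intros fc)
      also have "\<dots> = \<eta> * integral {0..R} (f e) + R * (L * \<eta>)"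
        using R by simp
      also have "\<dots> \<le> \<eta> * K + R * (L * \<eta>)" using elim \<eta> by simp
      finally show ?case unfolding eq by (simp add: algebra_simps)
    qed
  qed
qed

lemma interior_null_mono:
  assumes "interior_null R f" "\<And>e r. 0 < e \<Longrightarrow> r \<in> {0..R} \<Longrightarrow> \<bar>h e r\<bar> \<le> C * \<bar>f e r\<bar>"
  shows "interior_null R h"
  unfolding interior_null_def
proof (intro ballI allI impI)
  fix r1 \<eta> :: real assume "r1 \<in> {0<..<R}" and \<eta>: "0 < \<eta>"
  then have r1: "0 < r1" "r1 < R" by auto
  have "0 < \<eta> / (\<bar>C\<bar> + 1)" using \<eta> by simp
  from interior_nullD[OF assms(1) r1 this] eventually_at_right_less[of 0]
  show "\<forall>\<^sub>F e in at_right 0. \<forall>r\<in>{0..r1}. \<bar>h e r\<bar> \<le> \<eta>"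
  proof eventually_elim
    case (elim e)
    show ?case
    proof
      fix r assume r: "r \<in> {0..r1}"
      have "\<bar>h e r\<bar> \<le> C * \<bar>f e r\<bar>" using assms(2)[of e r] elim r r1 by auto
      also have "\<dots> \<le> (\<bar>C\<bar> + 1) * \<bar>f e r\<bar>" by (intro mult_right_mono) auto
      also have "\<dots> \<le> (\<bar>C\<bar> + 1) * (\<eta> / (\<bar>C\<bar> + 1))"
        using elim r by (intro mult_left_mono) auto
      finally show "\<bar>h e r\<bar> \<le> \<eta>" by simp
    qed
  qed
qed

lemma interior_null_isCont:
  assumes f: "interior_null R f" and \<phi>: "isCont \<phi> 0" "\<phi> 0 = (0::real)"
  shows "interior_null R (\<lambda>e r. \<phi> (f e r))"
  unfolding interior_null_def
proof (intro ballI allI impI)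
  fix r1 \<eta> :: real assume "r1 \<in> {0<..<R}" and \<eta>: "0 < \<eta>"
  then have r1: "0 < r1" "r1 < R" by auto
  obtain d where d: "0 < d" "\<And>x. dist x 0 < d \<Longrightarrow> dist (\<phi> x) (\<phi> 0) < \<eta>"
    using \<phi>(1) \<eta> unfolding continuous_at_eps_delta by blast
  have "0 < d / 2" using d by simp
  from interior_nullD[OF f r1 this]
  show "\<forall>\<^sub>F e in at_right 0. \<forall>r\<in>{0..r1}. \<bar>\<phi> (f e r)\<bar> \<le> \<eta>"
  proof eventually_elim
    case (elim e)
    show ?case
    proof
      fix r assume "r \<in> {0..r1}"
      then have "dist (f e r) 0 < d" using elim d(1) by fastforce
      from d(2)[OF this] show "\<bar>\<phi> (f e r)\<bar> \<le> \<eta>" using \<phi>(2) by simp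
    qed
  qed
qed

lemma interior_null_shift:
  assumes "interior_null R (\<lambda>e r. f e r - c e)" "(c \<longlongrightarrow> 0) (at_right 0)"
  shows "interior_null R f"
  unfolding interior_null_def
proof (intro ballI allI impI)
  fix r1 \<eta> :: real assume "r1 \<in> {0<..<R}" and \<eta>: "0 < \<eta>"
  then have r1: "0 < r1" "r1 < R" by auto
  have \<eta>2: "0 < \<eta> / 2" using \<eta> by simp
  have "\<forall>\<^sub>F e in at_right 0. \<bar>c e\<bar> < \<eta> / 2"
    using tendstoD[OF assms(2) \<eta>2] by simp
  with interior_nullD[OF assms(1) r1 \<eta>2]
  show "\<forall>\<^sub>F e in at_right 0. \<forall>r\<in>{0..r1}. \<bar>f e r\<bar> \<le> \<eta>"
  proof eventually_elim
    case (elim e)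
    have "\<bar>f e r\<bar> \<le> \<eta>" if "r \<in> {0..r1}" for r
      using elim(1)[rule_format, OF that] elim(2) by linarith
    then show ?case by blast
  qed
qed

lemma interior_null_tendsto:
  assumes "interior_null R f" "0 \<le> r" "r < R"
  shows "((\<lambda>e. f e r) \<longlongrightarrow> 0) (at_right 0)"
proof (rule tendstoI)
  fix d :: real assume "0 < d"
  then have "\<forall>\<^sub>F e in at_right 0. \<forall>s\<in>{0..(r + R) / 2}. \<bar>f e s\<bar> \<le> d / 2"
    using assms by (intro interior_nullD) auto
  then show "\<forall>\<^sub>F e in at_right 0. dist (f e r) 0 < d"
  proof eventually_elim
    case (elim e)
    then have "\<bar>f e r\<bar> \<le> d / 2" using assms by simp
    then show ?case using \<open>0 < d\<close> by simp
  qed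
qed

text \<open>Concentration reduces an arbitrary test function to its value at \<open>R\<close>, so
  only the limit of the total mass has to be computed.\<close>

lemma weak_diracI:
  assumes R: "0 < R" and f: "interior_null R f"
    and cont: "\<And>e. 0 < e \<Longrightarrow> continuous_on {0..R} (f e)"
    and nonneg: "\<And>e r. 0 < e \<Longrightarrow> r \<in> {0..R} \<Longrightarrow> 0 \<le> f e r"
    and int: "((\<lambda>e. integral {0..R} (f e)) \<longlongrightarrow> C) (at_right 0)"
  shows "weak_dirac R f C"
  unfolding weak_dirac_def
proof (intro allI impI)
  fix h :: "real \<Rightarrow> real" assume h: "continuous_on {0..R} h"
  have "\<forall>\<^sub>F e in at_right 0. integral {0..R} (f e) < C + 1"
    using order_tendstoD(2)[OF int, of "C + 1"] by simp
  then have "\<forall>\<^sub>F e in at_right 0. integral {0..R} (f e) \<le> C + 1"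
    by eventually_elim simp
  from tendsto_add[OF interior_null_integral_concentrates[OF R f h cont nonneg this] tendsto_mult_left[OF int, of "h R"]]
  show "((\<lambda>e. integral {0..R} (\<lambda>r. h r * f e r)) \<longlongrightarrow> C * h R) (at_right 0)"
    by (simp add: mult.commute)
qed

text \<open>Comparing interior points suffices: the endpoints, where the two-sided
  \<open>deriv (U e)\<close> need not equal the one-sided derivative, form a null set.\<close>

lemma weak_dirac_cong:
  assumes "\<And>e r. 0 < e \<Longrightarrow> r \<in> {0<..<R} \<Longrightarrow> f e r = f' e r" and "weak_dirac R f C"
  shows "weak_dirac R f' C"
  unfolding weak_dirac_def
proof (intro allI impI)
  fix h :: "real \<Rightarrow> real" assume h: "continuous_on {0..R} h"
  have "integral {0..R} (\<lambda>r. h r * f e r) = integral {0..R} (\<lambda>r. h r * f' e r)" if "0 < e" for e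
    by (rule integral_spike[of "{0, R}"]) (use assms(1)[OF that] in auto)
  then have "\<forall>\<^sub>F e in at_right 0. integral {0..R} (\<lambda>r. h r * f e r) = integral {0..R} (\<lambda>r. h r * f' e r)"
    using eventually_at_right_less[of 0] by (auto elim: eventually_mono)
  with assms(2) h show "((\<lambda>e. integral {0..R} (\<lambda>r. h r * f' e r)) \<longlongrightarrow> C * h R) (at_right 0)"
    unfolding weak_dirac_def by (auto elim: Lim_transform_eventually)
qed

lemma weak_dirac_uminus: "weak_dirac R f C \<Longrightarrow> weak_dirac R (\<lambda>e r. - f e r) (- C)"
  unfolding weak_dirac_def using tendsto_minus by fastforce

section \<open>\<open>L^\<theta>\<close> norms and rates\<close>

lemma Lnorm_cong:
  assumes "\<And>r. r \<in> {0<..<R} \<Longrightarrow> \<bar>f r\<bar> = \<bar>h r\<bar>"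
  shows "Lnorm R \<theta> f = Lnorm R \<theta> h"
proof -
  have "integral {0..R} (\<lambda>r. \<bar>f r\<bar> powr \<theta>) = integral {0..R} (\<lambda>r. \<bar>h r\<bar> powr \<theta>)"
    by (rule integral_spike[of "{0, R}"]) (use assms in auto)
  then show ?thesis by (simp add: Lnorm_def)
qed

lemma Lconv0_I:
  assumes "0 < \<theta>" "((\<lambda>e. integral {0..R} (\<lambda>r. \<bar>f e r\<bar> powr \<theta>)) \<longlongrightarrow> 0) (at_right 0)"
  shows "Lconv0 R \<theta> f"
proof -
  \<comment> \<open>\<open>integral\<close> is 0 by convention for a function that is not
    integrable, so the sign is right in that case as well.\<close>
  have "0 \<le> integral {0..R} (\<lambda>r. \<bar>f e r\<bar> powr \<theta>)" for e
    by (cases "(\<lambda>r. \<bar>f e r\<bar> powr \<theta>) integrable_on {0..R}")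
      (auto intro: integral_nonneg simp: not_integrable_integral)
  then show ?thesis
    using tendsto_powr2[OF assms(2) tendsto_const, of "1 / \<theta>"] assms(1)
    by (simp add: Lconv0_def Lnorm_def)
qed

lemma eventually_le_scaled:
  assumes "0 < \<eta>" shows "\<forall>\<^sub>F e in at_right (0::real). e\<^sup>2 * c \<le> \<eta>"
proof -
  have "((\<lambda>e. e\<^sup>2 * c) \<longlongrightarrow> 0\<^sup>2 * c) (at_right (0::real))" by (intro tendsto_intros)
  then have "\<forall>\<^sub>F e in at_right 0. e\<^sup>2 * c < \<eta>" using assms by (intro order_tendstoD(2)) auto
  then show ?thesis by eventually_elim simp
qed

lemma power2_powr_half: "0 < x \<Longrightarrow> (x\<^sup>2) powr (y / 2) = x powr y" for x y :: real
  using powr_powr[of x 2 "y / 2"] by simp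

text \<open>Interpolation at the level \<open>l\<close>: for t >= 0 one has t^\<theta> <= l^\<theta>
  + l^(\<theta>-1) t, by comparing t with \<open>l\<close>. An \<open>L^1\<close> bound of order
  \<open>l\<close> thus gives an \<open>L^\<theta>\<close> bound of the same order.\<close>

lemma powr_mean_le:
  fixes f :: "real \<Rightarrow> real"
  assumes R: "0 < R" and \<theta>: "0 < \<theta>" "\<theta> \<le> 1" and f: "continuous_on {0..R} f"
    and nonneg: "\<And>r. r \<in> {0..R} \<Longrightarrow> 0 \<le> f r" and l: "0 < l" and int: "integral {0..R} f \<le> C * l"
  shows "integral {0..R} (\<lambda>r. \<bar>f r\<bar> powr \<theta>) \<le> (R + C) * l powr \<theta>"
proof -
  have split: "l powr \<theta> = l powr (\<theta> - 1) * l"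
    using l by (simp add: powr_diff)
  have "\<bar>f r\<bar> powr \<theta> \<le> l powr \<theta> + l powr (\<theta> - 1) * f r" if r: "r \<in> {0..R}" for r
  proof (cases "f r \<le> l")
    case True
    then have "\<bar>f r\<bar> powr \<theta> \<le> l powr \<theta>" using nonneg[OF r] \<theta> by (intro powr_mono2) auto
    moreover have "0 \<le> l powr (\<theta> - 1) * f r" using nonneg[OF r] by simp
    ultimately show ?thesis by linarith
  next
    case False
    then have "f r powr (\<theta> - 1) * f r \<le> l powr (\<theta> - 1) * f r"
      using l \<theta> by (intro mult_right_mono powr_mono2') auto
    moreover have "f r powr \<theta> = f r powr (\<theta> - 1) * f r" using False l by (simp add: powr_diff)
    ultimately show ?thesis using False l by (simp add: add_increasing)
  qed
  then have "integral {0..R} (\<lambda>r. \<bar>f r\<bar> powr \<theta>) \<le> integral {0..R} (\<lambda>r. l powr \<theta> + l powr (\<theta> - 1) * f r)"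
    using \<theta> by (intro integral_le integrable_continuous_real continuous_on_powr' continuous_intros f) auto
  also have "\<dots> = integral {0..R} (\<lambda>r. l powr \<theta>) + integral {0..R} (\<lambda>r. l powr (\<theta> - 1) * f r)"
    by (intro integral_add integrable_continuous_real continuous_intros f)
  also have "\<dots> = R * l powr \<theta> + l powr (\<theta> - 1) * integral {0..R} f" using R by simp
  also have "\<dots> \<le> R * l powr \<theta> + l powr (\<theta> - 1) * (C * l)"
    using int by (intro add_left_mono mult_left_mono) auto
  finally show ?thesis by (simp add: split algebra_simps)
qed

lemma Lnorm_le_powr:
  assumes "0 < \<theta>" "(\<lambda>r. \<bar>f r\<bar> powr \<theta>) integrable_on {0..R}"
    and "integral {0..R} (\<lambda>r. \<bar>f r\<bar> powr \<theta>) \<le> C * x powr \<theta>" "0 \<le> C" "0 \<le> x"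
  shows "Lnorm R \<theta> f \<le> C powr (1 / \<theta>) * x"
proof -
  have "Lnorm R \<theta> f \<le> (C * x powr \<theta>) powr (1 / \<theta>)"
    unfolding Lnorm_def using assms by (intro powr_mono2 integral_nonneg) auto
  also have "\<dots> = C powr (1 / \<theta>) * x"
    using assms by (simp add: powr_mult powr_powr)
  finally show ?thesis .
qed

lemma rate_tendsto_0:
  assumes "0 < (\<alpha>::real)"
  shows "((\<lambda>e. e powr \<alpha> * (if P then ln (1 / e) else 1)) \<longlongrightarrow> 0) (at_right 0)"
proof (cases P)
  case True
  have "((\<lambda>e. e powr \<alpha> * ln (1 / e)) \<longlongrightarrow> 0) (at_right 0)" using assms by real_asymp
  then show ?thesis using True by simp
next
  case False
  have "((\<lambda>e. e powr \<alpha>) \<longlongrightarrow> 0) (at_right 0)" using assms by real_asymp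
  then show ?thesis using False by simp
qed

text \<open>A positive power of \<open>e\<close> beats the logarithm; \<theta> < 2 is what makes the
  exponent positive.\<close>

lemma Lconv0_of_rate:
  assumes \<theta>: "\<theta> \<in> {0<..<2}" and bd: "\<forall>\<^sub>F e in at_right 0. Lnorm R \<theta> (f e)
      \<le> C * e powr (min 1 (2 / \<theta> - 1)) * (if \<theta> \<le> 1 then ln (1 / e) else 1)"
  shows "Lconv0 R \<theta> f"
  unfolding Lconv0_def
proof (rule tendsto_sandwich[where f="\<lambda>_. 0", OF _ bd])
  have "0 < min 1 (2 / \<theta> - 1)" using \<theta> by (auto simp: field_simps)
  from tendsto_mult_left[OF rate_tendsto_0[OF this, of "\<theta> \<le> 1"], of C]
  show "((\<lambda>e. C * e powr (min 1 (2 / \<theta> - 1)) * (if \<theta> \<le> 1 then ln (1 / e) else 1)) \<longlongrightarrow> 0) (at_right 0)"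
    by (simp only: mult.assoc mult_zero_right)
qed (auto simp: Lnorm_def)

section \<open>Monotonicity and interior bounds\<close>

text \<open>Divergence form of the equation, after multiplication by r^(N-1): the derivative of
  \<open>g\<close> is absorbed into the flux. \<open>w\<close> is the derivative of \<open>U\<close>
  up to the endpoints, one-sided there. The order of \<open>A\<close> and \<open>B\<close> is left
  open, so that the notion is stable under passing to \<open>- U\<close>.\<close>

definition radial_solution ::
  "nat \<Rightarrow> real \<Rightarrow> (real \<Rightarrow> real) \<Rightarrow> real \<Rightarrow> real \<Rightarrow> real \<Rightarrow> real \<Rightarrow> real \<Rightarrow>
    (real \<Rightarrow> real) \<Rightarrow> (real \<Rightarrow> real) \<Rightarrow> bool" where
  "radial_solution N R g A B p q e U w \<longleftrightarrow>
    (\<forall>r\<in>{0..R}. (U has_real_derivative w r) (at r within {0..R})) \<and> continuous_on {0..R} w \<and>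
    w 0 = 0 \<and> w R = R * (A - B) / (e\<^sup>2 * real N * g R) \<and>
    integral {0..R} (\<lambda>s. s ^ (N - 1) * U s) = 0 \<and>
    (\<forall>r\<in>{0<..<R}. ((\<lambda>r. e\<^sup>2 * (r ^ (N - 1) * g r * w r)) has_real_derivative
      r ^ (N - 1) * (R ^ N / real N *
        (A * exp (p * U r) / integral {0..R} (\<lambda>s. s ^ (N - 1) * exp (p * U s))
         - B * exp (- q * U r) / integral {0..R} (\<lambda>s. s ^ (N - 1) * exp (- q * U s))))) (at r))"

text \<open>The opposite sign of A - B is reached by interpreting this locale at \<open>- U\<close>
  with the constants exchanged.\<close>

locale radial_family =
  fixes N :: nat and R A B p q M :: real and g :: "real \<Rightarrow> real" and U w :: "real \<Rightarrow> real \<Rightarrow> real"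
  assumes N: "2 \<le> N" and R: "0 < R" and B: "0 < B" and AB: "B < A" and p: "0 < p" and q: "0 < q"
    and g_cont: "continuous_on {0..R} g" and g_pos: "r \<in> {0..R} \<Longrightarrow> 0 < g r"
    and g_le: "r \<in> {0..R} \<Longrightarrow> g r \<le> M"
    and solution: "0 < e \<Longrightarrow> radial_solution N R g A B p q e (U e) (w e)"
begin

definition "m = R ^ N / real N"
text \<open>For fixed \<open>e\<close> the nonlocal denominators are mere numbers. Collected in
  \<open>a e\<close> and \<open>b e\<close>, they make \<open>F e\<close> an increasing function of
  \<open>U e\<close> alone.\<close>

definition "a e = m * A / integral {0..R} (\<lambda>s. s ^ (N - 1) * exp (p * U e s))"
definition "b e = m * B / integral {0..R} (\<lambda>s. s ^ (N - 1) * exp (- q * U e s))"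
definition "F e r = a e * exp (p * U e r) - b e * exp (- q * U e r)"
definition "G e r = e\<^sup>2 * (r ^ (N - 1) * g r * w e r)"

lemma U_deriv: "0 < e \<Longrightarrow> r \<in> {0..R} \<Longrightarrow> (U e has_real_derivative w e r) (at r within {0..R})"
  and w_cont: "0 < e \<Longrightarrow> continuous_on {0..R} (w e)"
  and w_0: "0 < e \<Longrightarrow> w e 0 = 0"
  and w_R: "0 < e \<Longrightarrow> w e R = R * (A - B) / (e\<^sup>2 * real N * g R)"
  and mean_0: "0 < e \<Longrightarrow> integral {0..R} (\<lambda>s. s ^ (N - 1) * U e s) = 0"
  using solution by (auto simp: radial_solution_def)

lemma A: "0 < A" and m: "0 < m"
  using B AB R N by (auto simp: m_def)

lemma DERIV_weight: "((\<lambda>r. r ^ N / real N) has_real_derivative r ^ (N - 1)) (at r within S)"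
  using N by (auto intro!: derivative_eq_intros simp: One_nat_def)

lemma weight_int: "integral {0..R} (\<lambda>s. s ^ (N - 1)) = m"
proof -
  have "((\<lambda>s. s ^ (N - 1)) has_integral R ^ N / real N - 0 ^ N / real N) {0..R}"
    using R by (intro fundamental_theorem_of_calculus)
      (auto intro!: DERIV_weight simp flip: has_real_derivative_iff_has_vector_derivative)
  then show ?thesis using N by (auto simp: m_def integral_unique power_0_left)
qed

lemma continuous_on_g [continuous_intros]:
  "S \<subseteq> {0..R} \<Longrightarrow> continuous_on S g"
  using g_cont continuous_on_subset by blast

context
  fixes e :: real
  assumes e: "0 < e"
begin

lemma continuous_on_U [continuous_intros]: "S \<subseteq> {0..R} \<Longrightarrow> continuous_on S (U e)"
  using U_deriv[OF e] by (meson DERIV_continuous_on has_field_derivative_subset in_mono)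

lemma continuous_on_w [continuous_intros]: "S \<subseteq> {0..R} \<Longrightarrow> continuous_on S (w e)"
  using w_cont[OF e] continuous_on_subset by blast

lemma continuous_on_F [continuous_intros]: "S \<subseteq> {0..R} \<Longrightarrow> continuous_on S (F e)"
  unfolding F_def by (intro continuous_intros)

lemma continuous_on_G [continuous_intros]: "S \<subseteq> {0..R} \<Longrightarrow> continuous_on S (G e)"
  unfolding G_def by (intro continuous_intros)

lemma DERIV_U: "r \<in> {0<..<R} \<Longrightarrow> (U e has_real_derivative w e r) (at r)"
  using U_deriv[OF e, of r] at_within_Icc_at[of 0 r R] by auto

lemma DERIV_G: "r \<in> {0<..<R} \<Longrightarrow> (G e has_real_derivative r ^ (N - 1) * F e r) (at r)"
  using solution[OF e] unfolding radial_solution_def G_def[abs_def] F_def a_def b_def m_def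
  by (simp add: algebra_simps)

text \<open>Jensen's inequality for the weight: integrate 1 + c U <= exp (c U) and use the zero mean
  of \<open>U e\<close>. With c = p and c = -q it bounds both coefficients from above.\<close>

lemma exp_moment_ge: "m \<le> integral {0..R} (\<lambda>s. s ^ (N - 1) * exp (c * U e s))"
proof -
  have "m = integral {0..R} (\<lambda>s. s ^ (N - 1)) + c * integral {0..R} (\<lambda>s. s ^ (N - 1) * U e s)"
    by (simp add: weight_int mean_0[OF e])
  also have "\<dots> = integral {0..R} (\<lambda>s. s ^ (N - 1)) + integral {0..R} (\<lambda>s. c * (s ^ (N - 1) * U e s))"
    by simp
  also have "\<dots> = integral {0..R} (\<lambda>s. s ^ (N - 1) + c * (s ^ (N - 1) * U e s))"
    by (intro integral_add[symmetric] integrable_continuous_real continuous_intros) auto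
  also have "\<dots> \<le> integral {0..R} (\<lambda>s. s ^ (N - 1) * exp (c * U e s))"
  proof (intro integral_le integrable_continuous_real continuous_intros)
    fix s assume "s \<in> {0..R}"
    then have "s ^ (N - 1) * (1 + c * U e s) \<le> s ^ (N - 1) * exp (c * U e s)"
      by (intro mult_left_mono exp_ge_add_one_self) auto
    then show "s ^ (N - 1) + c * (s ^ (N - 1) * U e s) \<le> s ^ (N - 1) * exp (c * U e s)"
      by (simp add: algebra_simps)
  qed auto
  finally show ?thesis .
qed

lemma a_pos: "0 < a e" and a_le: "a e \<le> A" and b_pos: "0 < b e" and b_le: "b e \<le> B"
  using exp_moment_ge[of p] exp_moment_ge[of "- q"] m A B
  by (auto simp: a_def b_def divide_simps mult_ac)

lemma F_mean: "integral {0..R} (\<lambda>s. s ^ (N - 1) * F e s) = m * (A - B)"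
proof -
  have "integral {0..R} (\<lambda>s. s ^ (N - 1) * F e s) =
    integral {0..R} (\<lambda>s. a e * (s ^ (N - 1) * exp (p * U e s)) - b e * (s ^ (N - 1) * exp (- q * U e s)))"
    by (simp add: F_def algebra_simps)
  also have "\<dots> = integral {0..R} (\<lambda>s. a e * (s ^ (N - 1) * exp (p * U e s)))
      - integral {0..R} (\<lambda>s. b e * (s ^ (N - 1) * exp (- q * U e s)))"
    by (intro integral_diff integrable_continuous_real continuous_intros) auto
  also have "\<dots> = m * (A - B)"
    using exp_moment_ge[of p] exp_moment_ge[of "- q"] m by (simp add: a_def b_def algebra_simps)
  finally show ?thesis .
qed

lemma G_0: "G e 0 = 0"
  using w_0[OF e] by (simp add: G_def)

text \<open>In the Neumann condition at \<open>R\<close> the factors e^2 and \<open>g R\<close>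
  cancel against those of the flux, so the total flux does not depend on \<open>e\<close>.\<close>

lemma G_R: "G e R = m * (A - B)"
proof -
  have "R ^ N = R * R ^ (N - 1)" using N by (cases N) (auto simp: One_nat_def)
  then show ?thesis using N e g_pos[of R] R unfolding G_def w_R[OF e] m_def by simp
qed

text \<open>Multiplying the equation by \<open>U - u\<close>, where \<open>u\<close> is the zero of the nonlinearity, shows that
  \<open>(U - u)\<^sup>2\<close> is nondecreasing; the boundary condition at \<open>R\<close> then fixes the sign.\<close>

lemma F_nonneg:
  assumes "r \<in> {0..R}"
  shows "0 \<le> F e r"
proof -
  define u where "u = ln (b e / a e) / (p + q)"
  have u: "(p + q) * u = ln (b e / a e)" using p q by (simp add: u_def)
  \<comment> \<open>With this positive factor taken out, \<open>F e s\<close> has the sign of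
    \<open>U e s - u\<close>.\<close>
  have F_eq: "F e s = a e * exp (- q * U e s) * (exp ((p + q) * U e s) - exp ((p + q) * u))" for s
    unfolding u using a_pos b_pos by (simp add: F_def algebra_simps flip: exp_add)
  have pos: "0 < a e * exp (- q * U e s)" for s using a_pos by simp
  have sgn1: "0 \<le> F e s \<longleftrightarrow> u \<le> U e s" for s
    unfolding F_eq using pos[of s] p q by (subst zero_le_mult_iff) auto
  have sgn2: "F e s \<le> 0 \<longleftrightarrow> U e s \<le> u" for s
    unfolding F_eq using pos[of s] p q by (subst mult_le_0_iff) auto
  have FU: "0 \<le> F e s * (U e s - u)" for s
    using sgn1[of s] sgn2[of s] by (auto simp: zero_le_mult_iff)
  have GU: "0 \<le> G e s * (U e s - u)" if s: "s \<in> {0..R}" for s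
  proof -
    have "G e 0 * (U e 0 - u) \<le> G e s * (U e s - u)"
    proof (rule interval_mono[where f="\<lambda>s. G e s * (U e s - u)"])
      show "continuous_on {0..s} (\<lambda>s. G e s * (U e s - u))"
        using s by (intro continuous_intros) auto
    next
      fix t assume t: "0 < t" "t < s"
      then have tR: "t \<in> {0<..<R}" using s by auto
      show "((\<lambda>s. G e s * (U e s - u)) has_real_derivative
        t ^ (N - 1) * (F e t * (U e t - u)) + e\<^sup>2 * (t ^ (N - 1) * g t * (w e t)\<^sup>2)) (at t)"
        by (rule derivative_eq_intros DERIV_G[OF tR] DERIV_U[OF tR] refl)+
          (simp add: G_def algebra_simps power2_eq_square)
      show "0 \<le> t ^ (N - 1) * (F e t * (U e t - u)) + e\<^sup>2 * (t ^ (N - 1) * g t * (w e t)\<^sup>2)"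
        using FU[of t] g_pos[of t] tR by (auto intro!: add_nonneg_nonneg mult_nonneg_nonneg)
    qed (use s in auto)
    then show ?thesis using G_0 by simp
  qed
  have wU: "0 \<le> w e s * (U e s - u)" if "s \<in> {0<..R}" for s
  proof -
    have "0 \<le> (e\<^sup>2 * (s ^ (N - 1) * g s)) * (w e s * (U e s - u))"
      using GU[of s] that by (auto simp: G_def mult_ac)
    moreover have "0 < e\<^sup>2 * (s ^ (N - 1) * g s)"
      using g_pos[of s] that e by (intro mult_pos_pos zero_less_power) auto
    ultimately show ?thesis by (simp add: zero_le_mult_iff)
  qed
  have sq: "(U e x - u)\<^sup>2 \<le> (U e y - u)\<^sup>2" if "0 \<le> x" "x \<le> y" "y \<le> R" for x y
  proof (rule interval_mono[where f="\<lambda>s. (U e s - u)\<^sup>2"])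
    show "continuous_on {x..y} (\<lambda>s. (U e s - u)\<^sup>2)" using that by (intro continuous_intros) auto
  next
    fix t assume t: "x < t" "t < y"
    then have tR: "t \<in> {0<..<R}" using that by auto
    show "((\<lambda>s. (U e s - u)\<^sup>2) has_real_derivative 2 * (w e t * (U e t - u))) (at t)"
      by (rule derivative_eq_intros DERIV_U[OF tR] refl)+ simp
    show "0 \<le> 2 * (w e t * (U e t - u))" using wU[of t] tR by simp
  qed (use that in auto)
  have "0 < G e R" using G_R m AB by simp
  then have UR: "u \<le> U e R" using GU[of R] R by (simp add: zero_le_mult_iff)
  show ?thesis
  proof (rule ccontr)
    assume "\<not> 0 \<le> F e r"
    then have less: "U e r < u" using sgn1[of r] by simp
    \<comment> \<open>If \<open>U e r\<close> lay below \<open>u\<close>, the value \<open>u\<close>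
      would be taken at some y >= r. There (U - u)^2 vanishes, and being nondecreasing it would
      vanish at \<open>r\<close> too.\<close>
    have "continuous_on {r..R} (U e)" using assms by (intro continuous_intros) auto
    then obtain y where y: "r \<le> y" "y \<le> R" "U e y = u"
      using IVT'[of "U e" r u R] less UR assms by auto
    then show False using sq[of r y] assms less by simp
  qed
qed

lemma flux_mono: "0 \<le> x \<Longrightarrow> x \<le> y \<Longrightarrow> y \<le> R \<Longrightarrow> G e x \<le> G e y"
  by (rule interval_mono[where f="G e" and f'="\<lambda>r. r ^ (N - 1) * F e r"])
    (auto intro!: continuous_intros DERIV_G F_nonneg mult_nonneg_nonneg)

lemma w_nonneg: assumes "r \<in> {0..R}" shows "0 \<le> w e r"
proof (cases "r = 0")
  case True
  then show ?thesis using w_0[OF e] by simp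
next
  case False
  then have "0 < r" using assms by simp
  moreover have "0 \<le> (e\<^sup>2 * (r ^ (N - 1) * g r)) * w e r"
    using flux_mono[of 0 r] assms unfolding G_0 by (auto simp: G_def mult_ac)
  moreover have "0 < e\<^sup>2 * (r ^ (N - 1) * g r)"
    using g_pos[of r] assms \<open>0 < r\<close> e by (intro mult_pos_pos zero_less_power) auto
  ultimately show ?thesis by (simp add: zero_le_mult_iff)
qed

lemma U_mono: "0 \<le> x \<Longrightarrow> x \<le> y \<Longrightarrow> y \<le> R \<Longrightarrow> U e x \<le> U e y"
  by (rule interval_mono[where f="U e" and f'="w e"])
    (auto intro!: continuous_intros DERIV_U w_nonneg)

lemma F_mono: "0 \<le> x \<Longrightarrow> x \<le> y \<Longrightarrow> y \<le> R \<Longrightarrow> F e x \<le> F e y"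
  using U_mono[of x y] a_pos b_pos p q by (auto simp: F_def intro!: diff_mono mult_left_mono)

text \<open>By monotonicity \<open>U e 0\<close> is the minimum of a function with weighted mean
  zero.\<close>

lemma U_0_le: "U e 0 \<le> 0"
proof -
  have "U e 0 * m = integral {0..R} (\<lambda>s. U e 0 * s ^ (N - 1))"
    by (simp add: weight_int)
  also have "\<dots> \<le> integral {0..R} (\<lambda>s. s ^ (N - 1) * U e s)"
    by (intro integral_le integrable_continuous_real continuous_intros)
      (auto simp: mult.commute intro!: mult_right_mono U_mono)
  finally show ?thesis using mean_0[OF e] m by (simp add: mult_le_0_iff)
qed

text \<open>\<open>B\<close> is the weighted mean of \<open>b e * exp (- q * U e r)\<close> over r,
  and this function is largest at the centre.\<close>

lemma b_exp_ge: "B \<le> b e * exp (- q * U e 0)"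
proof -
  have "integral {0..R} (\<lambda>s. s ^ (N - 1) * exp (- q * U e s))
    \<le> integral {0..R} (\<lambda>s. exp (- q * U e 0) * s ^ (N - 1))"
    using q by (intro integral_le integrable_continuous_real continuous_intros)
      (auto simp: mult.commute intro!: mult_left_mono U_mono)
  also have "\<dots> = exp (- q * U e 0) * m" by (simp add: weight_int)
  finally show ?thesis using exp_moment_ge[of "- q"] m B
    by (simp add: b_def divide_simps mult_ac)
qed

text \<open>At the centre, \<open>F e 0 \<ge> 0\<close> passes the lower bound for the
  \<open>b\<close> term on to the \<open>a\<close> term, which then grows with r. This bound,
  uniform in \<open>e\<close>, is what makes \<open>F e\<close> grow at least linearly with
  \<open>U e\<close>.\<close>

lemma a_exp_ge: "r \<in> {0..R} \<Longrightarrow> B \<le> a e * exp (p * U e r)"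
proof -
  assume "r \<in> {0..R}"
  then have "a e * exp (p * U e 0) \<le> a e * exp (p * U e r)"
    using a_pos p U_mono[of 0 r] by auto
  moreover have "B \<le> a e * exp (p * U e 0)"
    using F_nonneg[of 0] b_exp_ge R by (simp add: F_def)
  ultimately show ?thesis by simp
qed

lemma a_ge: "B \<le> a e"
proof -
  have "a e * exp (p * U e 0) \<le> a e * 1"
    using a_pos p U_0_le by (intro mult_left_mono) (auto simp: mult_le_0_iff)
  then show ?thesis using a_exp_ge[of 0] R by simp
qed

lemma exp_U_ge: "r \<in> {0..R} \<Longrightarrow> B / A \<le> exp (p * U e r)"
proof -
  assume r: "r \<in> {0..R}"
  have "a e * exp (p * U e r) \<le> A * exp (p * U e r)" using a_le by simp
  then have "B \<le> A * exp (p * U e r)" using a_exp_ge[OF r] by linarith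
  then show ?thesis using A by (simp add: divide_simps mult.commute)
qed

text \<open>The lower bound for \<open>a e\<close> read backwards: it bounds the integral in its
  denominator.\<close>

lemma exp_moment_le: "integral {0..R} (\<lambda>s. s ^ (N - 1) * exp (p * U e s)) \<le> m * A / B"
  using a_ge exp_moment_ge[of p] m B A by (simp add: a_def divide_simps mult_ac)

text \<open>The integrated form of F' >= p B w, from exp t >= 1 + t with t = p (U y - U x). The
  \<open>b\<close> term only helps, because exp (- q U) decreases in r.\<close>

lemma F_diff_ge:
  assumes "0 \<le> x" "x \<le> y" "y \<le> R"
  shows "p * B * (U e y - U e x) \<le> F e y - F e x"
proof -
  have 1: "b e * exp (- q * U e y) \<le> b e * exp (- q * U e x)"
    using U_mono[OF assms] b_pos q by auto
  have "p * B * (U e y - U e x) \<le> p * (a e * exp (p * U e x)) * (U e y - U e x)"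
    using a_exp_ge[of x] assms U_mono[OF assms] p by (intro mult_right_mono) auto
  also have "\<dots> = a e * exp (p * U e x) * (p * (U e y - U e x))" by simp
  also have "\<dots> \<le> a e * exp (p * U e x) * (exp (p * (U e y - U e x)) - 1)"
    using a_pos exp_ge_add_one_self[of "p * (U e y - U e x)"] 
    by (intro mult_left_mono) (linarith, simp)
  also have "\<dots> = a e * exp (p * U e y) - a e * exp (p * U e x)"
    by (simp add: algebra_simps flip: exp_add)
  finally show ?thesis using 1 by (simp add: F_def)
qed

text \<open>As \<open>F e\<close> is nondecreasing, its weighted mass on \<open>{x..R}\<close> is at
  least \<open>F e x\<close> times (R^N - x^N) / N, while the total mass is m (A - B).\<close>

lemma F_le:
  assumes "0 \<le> x" "x < R"
  shows "F e x \<le> R ^ N * (A - B) / (R ^ N - x ^ N)"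
proof -
  have "G e x - F e x * (x ^ N / real N) \<le> G e R - F e x * (R ^ N / real N)"
  proof (rule interval_mono[where f="\<lambda>r. G e r - F e x * (r ^ N / real N)"])
    show "continuous_on {x..R} (\<lambda>r. G e r - F e x * (r ^ N / real N))"
      using assms N by (intro continuous_intros) auto
  next
    fix t assume t: "x < t" "t < R"
    then have tR: "t \<in> {0<..<R}" using assms by auto
    show "((\<lambda>r. G e r - F e x * (r ^ N / real N)) has_real_derivative
      t ^ (N - 1) * (F e t - F e x)) (at t)"
      by (rule derivative_eq_intros DERIV_G[OF tR] DERIV_weight refl)+ (simp add: algebra_simps)
    show "0 \<le> t ^ (N - 1) * (F e t - F e x)"
      using F_mono[of x t] assms t by auto
  qed (use assms in auto)
  moreover have "0 \<le> G e x" using flux_mono[of 0 x] G_0 assms by simp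
  ultimately have "F e x * (R ^ N - x ^ N) / real N \<le> R ^ N * (A - B) / real N"
    unfolding G_R m_def by (simp add: right_diff_distrib diff_divide_distrib)
  then have "F e x * (R ^ N - x ^ N) \<le> R ^ N * (A - B)"
    using N by (simp add: divide_le_cancel)
  moreover have "x ^ N < R ^ N" using assms N by (intro power_strict_mono) auto
  ultimately show ?thesis by (simp add: pos_le_divide_eq)
qed

text \<open>The monotonicity of \<open>F\<close> turns the mass of \<open>F\<close> on \<open>{x..y}\<close> into a lower bound for \<open>w\<close>
  further to the right, and hence for the growth of \<open>F\<close> itself, which \<open>F_le\<close> bounds.\<close>

lemma F_interior_aux:
  assumes "0 \<le> x" "x < y" "y < z" "z < R"
  shows "F e x * (p * B * (z - y) * (y ^ N - x ^ N) / (real N * (R ^ (N - 1) * M)))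
    \<le> e\<^sup>2 * (R ^ N * (A - B) / (R ^ N - z ^ N))"
proof -
  define c where "c = F e x * (y ^ N - x ^ N) / real N / (R ^ (N - 1) * M)"
  have M: "0 < M" using g_pos[of R] g_le[of R] R by simp
  have G_ge: "F e x * (y ^ N - x ^ N) / real N \<le> G e r" if "y \<le> r" "r \<le> R" for r
  proof -
    have "G e x - F e x * (x ^ N / real N) \<le> G e y - F e x * (y ^ N / real N)"
    proof (rule interval_mono[where f="\<lambda>r. G e r - F e x * (r ^ N / real N)"])
      show "continuous_on {x..y} (\<lambda>r. G e r - F e x * (r ^ N / real N))"
        using assms N by (intro continuous_intros) auto
    next
      fix t assume t: "x < t" "t < y"
      then have tR: "t \<in> {0<..<R}" using assms by auto
      show "((\<lambda>r. G e r - F e x * (r ^ N / real N)) has_real_derivative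
        t ^ (N - 1) * (F e t - F e x)) (at t)"
        by (rule derivative_eq_intros DERIV_G[OF tR] DERIV_weight refl)+ (simp add: algebra_simps)
      show "0 \<le> t ^ (N - 1) * (F e t - F e x)"
        using F_mono[of x t] assms t by auto
    qed (use assms in auto)
    moreover have "0 \<le> G e x" using flux_mono[of 0 x] G_0 assms by simp
    moreover have "G e y \<le> G e r" using flux_mono assms that by simp
    ultimately show ?thesis by (simp add: right_diff_distrib diff_divide_distrib)
  qed
  \<comment> \<open>The flux bound is solved for \<open>w\<close>, using that the weight
    \<open>r ^ (N - 1) * g r\<close> is at most \<open>R ^ (N - 1) * M\<close>.\<close>
  have w_ge: "c \<le> e\<^sup>2 * w e r" if "y \<le> r" "r \<le> R" for r
  proof -
    have "G e r = (r ^ (N - 1) * g r) * (e\<^sup>2 * w e r)" by (simp add: G_def)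
    also have "\<dots> \<le> (R ^ (N - 1) * M) * (e\<^sup>2 * w e r)"
      using that assms w_nonneg[of r] g_pos[of r] g_le[of r] 
      by (intro mult_right_mono mult_mono power_mono) auto
    finally have "F e x * (y ^ N - x ^ N) / real N \<le> (R ^ (N - 1) * M) * (e\<^sup>2 * w e r)"
      using G_ge[OF that] by linarith
    moreover have "0 < R ^ (N - 1) * M" using M R by simp
    ultimately show ?thesis unfolding c_def by (subst pos_divide_le_eq) (simp_all add: mult.commute)
  qed
  have "c * (z - y) \<le> e\<^sup>2 * (U e z - U e y)"
  proof -
    have "e\<^sup>2 * U e y - c * y \<le> e\<^sup>2 * U e z - c * z"
    proof (rule interval_mono[where f="\<lambda>r. e\<^sup>2 * U e r - c * r"])
      show "continuous_on {y..z} (\<lambda>r. e\<^sup>2 * U e r - c * r)"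
        using assms by (intro continuous_intros) auto
    next
      fix t assume t: "y < t" "t < z"
      then have tR: "t \<in> {0<..<R}" using assms by auto
      show "((\<lambda>r. e\<^sup>2 * U e r - c * r) has_real_derivative e\<^sup>2 * w e t - c) (at t)"
        by (auto intro!: derivative_eq_intros DERIV_U[OF tR])
      show "0 \<le> e\<^sup>2 * w e t - c" using w_ge[of t] t assms by simp
    qed (use assms in auto)
    then show ?thesis by (simp add: algebra_simps)
  qed
  then have "p * B * (c * (z - y)) \<le> p * B * (e\<^sup>2 * (U e z - U e y))"
    using p B by (intro mult_left_mono) auto
  also have "\<dots> = e\<^sup>2 * (p * B * (U e z - U e y))" by simp
  also have "\<dots> \<le> e\<^sup>2 * F e z"
    using F_diff_ge[of y z] F_nonneg[of y] assms by (intro mult_left_mono) auto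
  also have "\<dots> \<le> e\<^sup>2 * (R ^ N * (A - B) / (R ^ N - z ^ N))"
    using F_le[of z] assms by (intro mult_left_mono) auto
  finally show ?thesis by (simp add: c_def mult_ac)
qed

end

section \<open>The energy\<close>

text \<open>The values at 0 are subtracted so that \<open>V e 0 = 0\<close>, matching
  \<open>G e 0 = 0\<close> in the comparisons below.\<close>

definition "V e r = a e / p * (exp (p * U e r) - exp (p * U e 0))
    + b e / q * (exp (- q * U e r) - exp (- q * U e 0))"

text \<open>The ratio of the derivatives of \<open>(G e r)\<^sup>2 / e\<^sup>2 / 2\<close> and
  \<open>V e r\<close>. It does not depend on \<open>e\<close>, so freezing it at \<open>R\<close>
  links the two quantities.\<close>

definition "k r = (r ^ (N - 1))\<^sup>2 * g r"

lemma M: "0 < M"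
  using g_pos[of R] g_le[of R] R by simp

lemma g_ge: "\<exists>c>0. \<forall>r\<in>{0..R}. c \<le> g r"
proof -
  obtain x where "x \<in> {0..R}" "\<forall>y\<in>{0..R}. g x \<le> g y"
    using continuous_attains_inf[OF _ _ g_cont] R by auto
  then show ?thesis using g_pos by blast
qed

lemma continuous_on_k: "continuous_on {0..R} k"
  unfolding k_def by (intro continuous_intros) auto

context
  fixes e :: real
  assumes e: "0 < e"
begin

lemmas cont_e = continuous_on_U[OF e] continuous_on_w[OF e] continuous_on_F[OF e] continuous_on_G[OF e]

lemma continuous_on_V: "S \<subseteq> {0..R} \<Longrightarrow> continuous_on S (V e)"
  unfolding V_def by (intro continuous_intros cont_e)

lemma DERIV_V: "r \<in> {0<..<R} \<Longrightarrow> (V e has_real_derivative F e r * w e r) (at r)"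
  unfolding V_def[abs_def] using p q
  by (auto intro!: derivative_eq_intros DERIV_U[OF e] simp: F_def algebra_simps)

lemma V_0: "V e 0 = 0"
  by (simp add: V_def)

lemma V_mono: "0 \<le> x \<Longrightarrow> x \<le> y \<Longrightarrow> y \<le> R \<Longrightarrow> V e x \<le> V e y"
  by (rule interval_mono[where f="V e" and f'="\<lambda>r. F e r * w e r"])
    (auto intro!: continuous_on_V DERIV_V mult_nonneg_nonneg F_nonneg[OF e] w_nonneg[OF e])

lemma V_nonneg: "r \<in> {0..R} \<Longrightarrow> 0 \<le> V e r"
  using V_mono[of 0 r] V_0 by simp

text \<open>By convexity, the tangent lines of both exponentials at \<open>U e r\<close> give V r <=
  F r (U r - U 0), and \<open>F_diff_ge\<close> bounds the increment of \<open>U\<close> by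
  \<open>F e r / (p * B)\<close>.\<close>

lemma V_le: assumes r: "r \<in> {0..R}" shows "V e r \<le> (F e r)\<^sup>2 / (p * B)"
proof -
  have 1: "exp (p * U e r) - exp (p * U e 0) \<le> p * exp (p * U e r) * (U e r - U e 0)"
    using mult_left_mono[OF exp_ge_add_one_self[of "p * (U e 0 - U e r)"], of "exp (p * U e r)"]
    by (simp add: algebra_simps flip: exp_add)
  have 2: "exp (- q * U e r) - exp (- q * U e 0) \<le> - q * exp (- q * U e r) * (U e r - U e 0)"
    using mult_left_mono[OF exp_ge_add_one_self[of "- q * (U e 0 - U e r)"], of "exp (- q * U e r)"]
    by (simp add: algebra_simps flip: exp_add)
  have "V e r \<le> a e / p * (p * exp (p * U e r) * (U e r - U e 0))
      + b e / q * (- q * exp (- q * U e r) * (U e r - U e 0))"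
    unfolding V_def using 1 2 a_pos[OF e] b_pos[OF e] p q by (intro add_mono mult_left_mono) auto
  also have "\<dots> = F e r * (U e r - U e 0)"
    using p q by (simp add: F_def algebra_simps)
  also have "\<dots> \<le> F e r * (F e r / (p * B))"
  proof (rule mult_left_mono)
    have "p * B * (U e r - U e 0) \<le> F e r"
      using F_diff_ge[OF e, of 0 r] F_nonneg[OF e, of 0] r by auto
    then show "U e r - U e 0 \<le> F e r / (p * B)"
      using p B by (simp add: pos_le_divide_eq mult.commute)
  qed (use F_nonneg[OF e] r in auto)
  finally show ?thesis by (simp add: power2_eq_square)
qed

lemma DERIV_G_sq:
  assumes "r \<in> {0<..<R}"
  shows "((\<lambda>r. (G e r)\<^sup>2 / e\<^sup>2 / 2) has_real_derivative k r * (F e r * w e r)) (at r)"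
proof -
  have "2 * G e r * (r ^ (N - 1) * F e r) / e\<^sup>2 / 2 = k r * (F e r * w e r)"
    using e by (simp add: k_def G_def power2_eq_square)
  moreover have "((\<lambda>r. (G e r)\<^sup>2 / e\<^sup>2 / 2) has_real_derivative
    2 * G e r * (r ^ (N - 1) * F e r) / e\<^sup>2 / 2) (at r)"
    using DERIV_cdivide[OF DERIV_cdivide[OF DERIV_power[OF DERIV_G[OF e assms], of 2]], of "e\<^sup>2" 2]
    by (simp add: mult_ac)
  ultimately show ?thesis by simp
qed

text \<open>On \<open>{0..r}\<close> the ratio \<open>k\<close> is at most
  \<open>(r ^ (N - 1))\<^sup>2 * M\<close>. The power of \<open>r\<close> is kept because it cancels
  against the one in \<open>(G e r)\<^sup>2\<close>, leaving a bound that is uniform down to the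
  centre.\<close>

lemma energy_le:
  assumes "r \<in> {0..R}"
  shows "(e * w e r)\<^sup>2 * (g r)\<^sup>2 \<le> 2 * M * V e r"
proof (cases "r = 0")
  case True
  then show ?thesis using V_0 w_0[OF e] by simp
next
  case False
  then have r: "0 < r" "r \<le> R" using assms by auto
  have "(r ^ (N - 1))\<^sup>2 * M * V e 0 - (G e 0)\<^sup>2 / e\<^sup>2 / 2 \<le> (r ^ (N - 1))\<^sup>2 * M * V e r - (G e r)\<^sup>2 / e\<^sup>2 / 2"
  proof (rule interval_mono[where f="\<lambda>t. (r ^ (N - 1))\<^sup>2 * M * V e t - (G e t)\<^sup>2 / e\<^sup>2 / 2"])
    show "continuous_on {0..r} (\<lambda>t. (r ^ (N - 1))\<^sup>2 * M * V e t - (G e t)\<^sup>2 / e\<^sup>2 / 2)"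
      using r e by (intro continuous_intros cont_e continuous_on_V) auto
  next
    fix t assume t: "0 < t" "t < r"
    then have tR: "t \<in> {0<..<R}" using r by auto
    show "((\<lambda>t. (r ^ (N - 1))\<^sup>2 * M * V e t - (G e t)\<^sup>2 / e\<^sup>2 / 2) has_real_derivative
      (r ^ (N - 1))\<^sup>2 * M * (F e t * w e t) - k t * (F e t * w e t)) (at t)"
      by (rule derivative_eq_intros DERIV_V[OF tR] DERIV_G_sq[OF tR] refl)+ simp
    have "k t \<le> (r ^ (N - 1))\<^sup>2 * M"
      unfolding k_def using t tR g_le[of t] g_pos[of t] by (intro mult_mono power_mono) auto
    moreover have "0 \<le> F e t * w e t"
      using tR by (auto intro!: mult_nonneg_nonneg F_nonneg[OF e] w_nonneg[OF e])
    ultimately show "0 \<le> (r ^ (N - 1))\<^sup>2 * M * (F e t * w e t) - k t * (F e t * w e t)"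
      by (simp add: mult_right_mono)
  qed (use r in auto)
  then have "(G e r)\<^sup>2 / e\<^sup>2 \<le> (r ^ (N - 1))\<^sup>2 * (2 * M * V e r)"
    using V_0 G_0[OF e] by simp
  moreover have "(G e r)\<^sup>2 / e\<^sup>2 = (r ^ (N - 1))\<^sup>2 * ((e * w e r)\<^sup>2 * (g r)\<^sup>2)"
    using e by (simp add: G_def power2_eq_square)
  ultimately show ?thesis using r by simp
qed

text \<open>The difference has derivative (k - k R) V', so its increments are at most
  \<open>L\<close> times those of \<open>V\<close> before \<open>c\<close> and \<open>\<eta>\<close>
  times those of \<open>V\<close> after \<open>c\<close>.\<close>

lemma energy_near:
  assumes c: "0 \<le> c" "c \<le> R" and r: "r \<in> {0..R}"
    and L: "\<And>s. s \<in> {0..R} \<Longrightarrow> \<bar>k s - k R\<bar> \<le> L"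
    and \<eta>: "\<And>s. s \<in> {c..R} \<Longrightarrow> \<bar>k s - k R\<bar> \<le> \<eta>"
  shows "\<bar>(G e r)\<^sup>2 / e\<^sup>2 / 2 - k R * V e r\<bar> \<le> L * V e c + \<eta> * V e r"
proof -
  define D where "D r = (G e r)\<^sup>2 / e\<^sup>2 / 2 - k R * V e r" for r
  have contD: "continuous_on S D" if "S \<subseteq> {0..R}" for S
    unfolding D_def using that e by (intro continuous_intros cont_e continuous_on_V) auto
  have DERIV_D: "(D has_real_derivative (k t - k R) * (F e t * w e t)) (at t)" if "t \<in> {0<..<R}" for t
    unfolding D_def
    by (rule derivative_eq_intros DERIV_V[OF that] DERIV_G_sq[OF that] refl)+ (simp add: algebra_simps)
  have le: "\<bar>D y - D x\<bar> \<le> K * (V e y - V e x)"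
    if xy: "0 \<le> x" "x \<le> y" "y \<le> R" and K: "\<And>s. s \<in> {x..y} \<Longrightarrow> \<bar>k s - k R\<bar> \<le> K" for x y K
  proof -
    \<comment> \<open>The choices \<sigma> = 1 and \<sigma> = -1 give the two halves of the absolute
      value.\<close>
    have *: "K * V e x - \<sigma> * D x \<le> K * V e y - \<sigma> * D y" if \<sigma>: "\<bar>\<sigma>\<bar> = 1" for \<sigma> :: real
    proof (rule interval_mono[where f="\<lambda>t. K * V e t - \<sigma> * D t"])
      show "continuous_on {x..y} (\<lambda>t. K * V e t - \<sigma> * D t)"
        using xy by (intro continuous_intros contD continuous_on_V) auto
    next
      fix t assume t: "x < t" "t < y"
      then have tR: "t \<in> {0<..<R}" using xy by auto
      show "((\<lambda>t. K * V e t - \<sigma> * D t) has_real_derivative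
        (K - \<sigma> * (k t - k R)) * (F e t * w e t)) (at t)"
        by (rule derivative_eq_intros DERIV_V[OF tR] DERIV_D[OF tR] refl)+ (simp add: algebra_simps)
      have "\<sigma> * (k t - k R) \<le> \<bar>\<sigma> * (k t - k R)\<bar>" by simp
      also have "\<dots> \<le> K" using K[of t] t \<sigma> by (simp add: abs_mult)
      finally show "0 \<le> (K - \<sigma> * (k t - k R)) * (F e t * w e t)"
        using tR by (auto intro!: mult_nonneg_nonneg F_nonneg[OF e] w_nonneg[OF e])
    qed (use xy in auto)
    show ?thesis using *[of 1] *[of "-1"] by (simp add: algebra_simps abs_le_iff)
  qed
  have L0: "0 \<le> L" and \<eta>0: "0 \<le> \<eta>" using L[of R] \<eta>[of R] c R by auto
  have D0: "D 0 = 0" by (simp add: D_def V_0 G_0[OF e])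
  show ?thesis
  proof (cases "r \<le> c")
    case True
    have "\<bar>D r\<bar> \<le> L * V e r" using le[of 0 r L] L r D0 V_0 by simp
    also have "\<dots> \<le> L * V e c" using V_mono[of r c] True r c L0 by (intro mult_left_mono) auto
    moreover have "0 \<le> \<eta> * V e r" using \<eta>0 V_nonneg[OF r] by simp
    ultimately show ?thesis by (simp add: D_def)
  next
    case False
    have "\<bar>D c\<bar> \<le> L * V e c" using le[of 0 c L] L c D0 V_0 by simp
    moreover have "\<bar>D r - D c\<bar> \<le> \<eta> * (V e r - V e c)" using le[of c r \<eta>] \<eta> c r False by simp
    moreover have "0 \<le> \<eta> * V e c" using \<eta>0 V_nonneg[of c] c by simp
    ultimately show ?thesis by (simp add: D_def algebra_simps)
  qed
qed

text \<open>Where k >= K, the function G^2 / (2 e^2) - K V is nondecreasing. So \<open>V\<close> can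
  grow no more than G^2 / (2 e^2) allows, and G is fixed at \<open>R\<close> by
  \<open>G_R\<close>.\<close>

lemma V_R_le:
  assumes c: "0 < c" "c \<le> R" and K: "0 < K" "\<And>s. s \<in> {c..R} \<Longrightarrow> K \<le> k s"
  shows "V e R \<le> V e c + (m * (A - B))\<^sup>2 / (2 * K) / e\<^sup>2"
proof -
  have "(G e c)\<^sup>2 / e\<^sup>2 / 2 - K * V e c \<le> (G e R)\<^sup>2 / e\<^sup>2 / 2 - K * V e R"
  proof (rule interval_mono[where f="\<lambda>t. (G e t)\<^sup>2 / e\<^sup>2 / 2 - K * V e t"])
    show "continuous_on {c..R} (\<lambda>t. (G e t)\<^sup>2 / e\<^sup>2 / 2 - K * V e t)"
      using c e by (intro continuous_intros cont_e continuous_on_V) auto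
  next
    fix t assume t: "c < t" "t < R"
    then have tR: "t \<in> {0<..<R}" using c by auto
    show "((\<lambda>t. (G e t)\<^sup>2 / e\<^sup>2 / 2 - K * V e t) has_real_derivative
      (k t - K) * (F e t * w e t)) (at t)"
      by (rule derivative_eq_intros DERIV_V[OF tR] DERIV_G_sq[OF tR] refl)+ (simp add: algebra_simps)
    show "0 \<le> (k t - K) * (F e t * w e t)"
      using tR K(2)[of t] t by (auto intro!: mult_nonneg_nonneg F_nonneg[OF e] w_nonneg[OF e])
  qed (use c in auto)
  moreover have "0 \<le> (G e c)\<^sup>2 / e\<^sup>2 / 2" by simp
  ultimately have "K * V e R \<le> K * V e c + (m * (A - B))\<^sup>2 / e\<^sup>2 / 2"
    unfolding G_R[OF e] by linarith
  then have "V e R \<le> (K * V e c + (m * (A - B))\<^sup>2 / e\<^sup>2 / 2) / K"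
    using K by (simp add: pos_le_divide_eq mult.commute)
  also have "\<dots> = V e c + (m * (A - B))\<^sup>2 / (2 * K) / e\<^sup>2"
    using K by (simp add: add_divide_distrib)
  finally show ?thesis .
qed

text \<open>\<open>exp_U_ge\<close> bounds \<open>U\<close> below uniformly in \<open>e\<close>, so
  this exponential cannot blow up in the boundary layer.\<close>

lemma exp_neg_U_le: assumes "r \<in> {0..R}" shows "exp (- q * U e r) \<le> exp (q / p * ln (A / B))"
proof -
  have "ln (B / A) \<le> p * U e r"
    using exp_U_ge[OF e assms] A B by (subst exp_le_cancel_iff[symmetric]) simp
  then have "- ln (A / B) / p \<le> U e r"
    using p A B by (simp add: ln_div pos_divide_le_eq mult.commute)
  then have "q * (- ln (A / B) / p) \<le> q * U e r" using q by (intro mult_left_mono) auto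
  then show ?thesis by simp
qed

text \<open>The leading term of \<open>V\<close> is \<open>a e / p * exp (p * U e r)\<close> with
  \<open>a e \<ge> B\<close>; the negative terms of \<open>V\<close> are bounded uniformly in
  \<open>e\<close>.\<close>

lemma exp_U_le:
  assumes "r \<in> {0..R}"
  shows "exp (p * U e r) \<le> p / B * V e r + (A + p * B / q * exp (q / p * ln (A / B))) / B"
proof -
  have "b e / q * exp (- q * U e 0) \<le> B / q * exp (q / p * ln (A / B))"
    using b_le[OF e] b_pos[OF e] exp_neg_U_le[of 0] q R by (intro mult_mono divide_right_mono) auto
  moreover have "0 \<le> b e / q * exp (- q * U e r)" using b_pos[OF e] q by simp
  moreover have "a e / p * exp (p * U e 0) \<le> A / p * 1"
    using a_le[OF e] a_pos[OF e] U_0_le[OF e] p by (intro mult_mono divide_right_mono) (auto simp: mult_le_0_iff)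
  moreover have "B / p * exp (p * U e r) \<le> a e / p * exp (p * U e r)"
    using a_ge[OF e] p by (intro mult_right_mono divide_right_mono) auto
  ultimately have "B / p * exp (p * U e r) \<le> V e r + A / p + B / q * exp (q / p * ln (A / B))"
    by (simp add: V_def right_diff_distrib)
  then have "p / B * (B / p * exp (p * U e r)) \<le> p / B * (V e r + A / p + B / q * exp (q / p * ln (A / B)))"
    using p B by (intro mult_left_mono) auto
  then show ?thesis using p B by (simp add: distrib_left add_divide_distrib)
qed

end

section \<open>Limits\<close>

lemma F_interior_null: "interior_null R F"
  unfolding interior_null_def
proof (intro ballI allI impI)
  fix x \<eta> :: real assume "x \<in> {0<..<R}" and \<eta>: "0 < \<eta>"
  then have x: "0 < x" "x < R" by auto
  \<comment> \<open>The intermediate points do not depend on \<open>e\<close>, so \<open>c\<close>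
    is a fixed positive number and the resulting bound is of order e^2.\<close>
  define z where "z = (x + R) / 2"
  define y where "y = (x + z) / 2"
  have yz: "x < y" "y < z" "z < R" using x by (auto simp: y_def z_def)
  define c where "c = p * B * (z - y) * (y ^ N - x ^ N) / (real N * (R ^ (N - 1) * M))"
  have "x ^ N < y ^ N" using x yz N by (intro power_strict_mono) auto
  then have c: "0 < c" using p B yz N R M unfolding c_def by simp
  from eventually_le_scaled[OF \<eta>, of "R ^ N * (A - B) / (R ^ N - z ^ N) / c"] eventually_at_right_less[of 0]
  show "\<forall>\<^sub>F e in at_right 0. \<forall>r\<in>{0..x}. \<bar>F e r\<bar> \<le> \<eta>"
  proof eventually_elim
    case (elim e)
    have "F e x * c \<le> e\<^sup>2 * (R ^ N * (A - B) / (R ^ N - z ^ N))"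
      using F_interior_aux[of e x y z] elim x yz by (simp add: c_def)
    then have "F e x \<le> e\<^sup>2 * (R ^ N * (A - B) / (R ^ N - z ^ N)) / c"
      using c pos_le_divide_eq by blast
    then have "F e x \<le> e\<^sup>2 * (R ^ N * (A - B) / (R ^ N - z ^ N) / c)"
      by simp
    then have le: "F e x \<le> \<eta>" using elim(1) by simp
    show ?case
    proof
      fix r assume "r \<in> {0..x}"
      then show "\<bar>F e r\<bar> \<le> \<eta>" using le F_nonneg[of e r] F_mono[of e r x] elim(2) x by simp
    qed
  qed
qed

lemma U_diff_interior_null: "interior_null R (\<lambda>e r. U e r - U e 0)"
proof (rule interior_null_mono[OF F_interior_null])
  fix e r assume *: "0 < (e::real)" "r \<in> {0..R}"
  have "p * B * (U e r - U e 0) \<le> F e r"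
    using F_diff_ge[of e 0 r] F_nonneg[of e 0] * by auto
  then have "U e r - U e 0 \<le> F e r / (p * B)"
    using p B by (simp add: pos_le_divide_eq mult.commute)
  then show "\<bar>U e r - U e 0\<bar> \<le> 1 / (p * B) * \<bar>F e r\<bar>"
    using U_mono[of e 0 r] F_nonneg[of e r] * by simp
qed

text \<open>The bound on the exponential moment gives equi-integrability, so \<open>U - U 0\<close> tends to zero in
  the weighted \<open>L\<^sup>1\<close> norm; as \<open>U\<close> has mean zero, this norm is a multiple of \<open>- U 0\<close>.\<close>

lemma U_0_tendsto: "((\<lambda>e. U e 0) \<longlongrightarrow> 0) (at_right 0)"
proof (rule tendsto_zero_at_right_leI)
  fix \<eta> :: real assume \<eta>: "0 < \<eta>"
  define D where "D e r = r ^ (N - 1) * (U e r - U e 0)" for e r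
  \<comment> \<open>\<open>D\<close> can exceed this height only where U - U 0 > 1 / \<eta>. The
    truncation is bounded and small inside, so its integral tends to 0.\<close>
  define T where "T e r = min (D e r) (R ^ (N - 1) / \<eta>)" for e r
  define K where "K = 2 / p\<^sup>2 * (m * A / B * (A / B))"
  have Dc: "continuous_on {0..R} (D e)" if "0 < e" for e
    unfolding D_def using that by (intro continuous_intros cont_e) auto
  have Tc: "continuous_on {0..R} (T e)" if "0 < e" for e
    unfolding T_def using Dc[OF that] by (intro continuous_intros)
  have D_nonneg: "0 \<le> D e r" if "0 < e" "r \<in> {0..R}" for e r
    using U_mono[of e 0 r] that by (simp add: D_def)
  have "interior_null R D"
  proof (rule interior_null_mono[OF U_diff_interior_null])
    fix e r assume "0 < (e::real)" "r \<in> {0..R}"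
    then show "\<bar>D e r\<bar> \<le> R ^ (N - 1) * \<bar>U e r - U e 0\<bar>"
      unfolding D_def abs_mult by (intro mult_right_mono) (auto intro: power_mono)
  qed
  moreover have T_nonneg: "0 \<le> T e r" if "0 < e" "r \<in> {0..R}" for e r
    using D_nonneg[OF that] R \<eta> by (simp add: T_def)
  ultimately have "interior_null R T"
    by (rule_tac interior_null_mono[where C=1]) (auto simp: T_def abs_le_iff D_nonneg)
  then have "((\<lambda>e. integral {0..R} (T e)) \<longlongrightarrow> 0) (at_right 0)"
  proof (rule interior_null_integral_tendsto_0[OF R])
    show "\<forall>\<^sub>F e in at_right 0. \<forall>r\<in>{0..R}. \<bar>T e r\<bar> \<le> R ^ (N - 1) / \<eta>"
      using eventually_at_right_less[of 0]
    proof eventually_elim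
      case (elim e)
      then show ?case using T_nonneg[of e] by (auto simp: T_def)
    qed
  qed (use Tc in \<open>auto intro: integrable_continuous_real\<close>)
  then have "\<forall>\<^sub>F e in at_right 0. integral {0..R} (T e) < \<eta>"
    using \<eta> by (intro order_tendstoD(2)) auto
  then show "\<forall>\<^sub>F e in at_right 0. \<bar>U e 0\<bar> \<le> (1 + K) / m * \<eta>"
    using eventually_at_right_less[of 0]
  proof eventually_elim
    case (elim e)
    have e: "0 < e" by fact
    define E where "E r = r ^ (N - 1) * exp (p * (U e r - U e 0))" for r
    have Ec: "continuous_on {0..R} E"
      unfolding E_def using e by (intro continuous_intros cont_e) auto
    have "integral {0..R} E = integral {0..R} (\<lambda>r. exp (- p * U e 0) * (r ^ (N - 1) * exp (p * U e r)))"
      unfolding E_def by (simp add: algebra_simps exp_diff exp_minus field_simps)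
    also have "\<dots> = exp (- p * U e 0) * integral {0..R} (\<lambda>r. r ^ (N - 1) * exp (p * U e r))"
      by simp
    also have "\<dots> \<le> A / B * (m * A / B)"
    proof (rule mult_mono)
      show "exp (- p * U e 0) \<le> A / B"
        using exp_U_ge[OF e, of 0] R A B by (simp add: exp_minus field_simps)
      show "0 \<le> integral {0..R} (\<lambda>r. r ^ (N - 1) * exp (p * U e r))"
        using exp_moment_ge[OF e, of p] m by simp
    qed (use exp_moment_le[OF e] A B in auto)
    finally have "2 * \<eta> / p\<^sup>2 * integral {0..R} E \<le> 2 * \<eta> / p\<^sup>2 * (A / B * (m * A / B))"
      using \<eta> by (intro mult_left_mono) auto
    then have E_le: "2 * \<eta> / p\<^sup>2 * integral {0..R} E \<le> K * \<eta>"
      by (simp add: K_def mult_ac)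
    have "D e r \<le> T e r + 2 * \<eta> / p\<^sup>2 * E r" if r: "r \<in> {0..R}" for r
    proof (cases "D e r \<le> R ^ (N - 1) / \<eta>")
      case True
      then show ?thesis using r \<eta> by (simp add: T_def E_def)
    next
      case False
      \<comment> \<open>Above the truncation 1 <= \<eta> d, hence d <= \<eta> d^2, and the quadratic
        Taylor term of exp (p d) dominates the square: the excess is at most of order \<eta> times
        the exponential moment.\<close>
      define d where "d = U e r - U e 0"
      have d0: "0 \<le> d" using U_mono[OF e, of 0 r] r by (simp add: d_def)
      have "r ^ (N - 1) * d \<le> R ^ (N - 1) * d"
        using r d0 by (intro mult_right_mono power_mono) auto
      then have "R ^ (N - 1) / \<eta> \<le> R ^ (N - 1) * d" using False by (simp add: D_def d_def)
      then have "R ^ (N - 1) * 1 \<le> R ^ (N - 1) * (\<eta> * d)"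
        using \<eta> by (simp add: pos_divide_le_eq mult_ac)
      then have "1 \<le> \<eta> * d" using R by (simp only: mult_le_cancel_left_pos zero_less_power)
      then have "1 * d \<le> \<eta> * d * d" using d0 by (intro mult_right_mono) auto
      also have "\<dots> = 2 * \<eta> / p\<^sup>2 * ((p * d)\<^sup>2 / 2)" using p by (simp add: power2_eq_square)
      also have "\<dots> \<le> 2 * \<eta> / p\<^sup>2 * exp (p * d)"
      proof (rule mult_left_mono)
        have "0 \<le> p * d" using d0 p by simp
        then show "(p * d)\<^sup>2 / 2 \<le> exp (p * d)"
          using exp_lower_Taylor_quadratic[of "p * d"] by linarith
      qed (use \<eta> in simp)
      finally have "r ^ (N - 1) * d \<le> r ^ (N - 1) * (2 * \<eta> / p\<^sup>2 * exp (p * d))"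
        using r by (intro mult_left_mono) auto
      then show ?thesis using T_nonneg[OF e r] by (simp add: D_def E_def d_def mult_ac)
    qed
    then have "integral {0..R} (D e) \<le> integral {0..R} (\<lambda>r. T e r + 2 * \<eta> / p\<^sup>2 * E r)"
      using Dc[OF e] Tc[OF e] Ec by (intro integral_le integrable_continuous_real continuous_intros) auto
    also have "\<dots> = integral {0..R} (T e) + integral {0..R} (\<lambda>r. 2 * \<eta> / p\<^sup>2 * E r)"
      using Tc[OF e] Ec by (intro integral_add integrable_continuous_real continuous_intros) auto
    also have "\<dots> = integral {0..R} (T e) + 2 * \<eta> / p\<^sup>2 * integral {0..R} E"
      by simp
    also have "\<dots> \<le> (1 + K) * \<eta>" using elim(1) E_le by (simp add: algebra_simps)
    finally have 1: "integral {0..R} (D e) \<le> (1 + K) * \<eta>" .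
    have "integral {0..R} (D e) = integral {0..R} (\<lambda>r. r ^ (N - 1) * U e r - U e 0 * r ^ (N - 1))"
      unfolding D_def by (simp add: algebra_simps)
    also have "\<dots> = integral {0..R} (\<lambda>r. r ^ (N - 1) * U e r) - integral {0..R} (\<lambda>r. U e 0 * r ^ (N - 1))"
      using e by (intro integral_diff integrable_continuous_real continuous_intros cont_e) auto
    also have "\<dots> = - U e 0 * m" by (simp add: mean_0[OF e] weight_int)
    finally have "- U e 0 * m \<le> (1 + K) * \<eta>" using 1 by simp
    then have "- U e 0 \<le> (1 + K) * \<eta> / m" using m by (simp add: pos_le_divide_eq)
    then show ?case using U_0_le[OF e] by simp
  qed
qed

lemma U_interior_null: "interior_null R U"
  by (rule interior_null_shift[OF U_diff_interior_null U_0_tendsto])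

text \<open>Squeezed between \<open>b_exp_ge\<close> and \<open>b_le\<close>, now that
  \<open>U e 0\<close> tends to 0.\<close>

lemma b_tendsto: "(b \<longlongrightarrow> B) (at_right 0)"
proof (rule tendsto_sandwich)
  have "((\<lambda>e. B / exp (- q * U e 0)) \<longlongrightarrow> B / exp (- q * 0)) (at_right 0)"
    by (intro tendsto_intros U_0_tendsto) auto
  then show "((\<lambda>e. B / exp (- q * U e 0)) \<longlongrightarrow> B) (at_right 0)" by simp
  show "\<forall>\<^sub>F e in at_right 0. B / exp (- q * U e 0) \<le> b e"
    using eventually_at_right_less[of 0]
    by eventually_elim (auto simp: pos_divide_le_eq simp del: exp_minus dest: b_exp_ge)
  show "\<forall>\<^sub>F e in at_right 0. b e \<le> B"
    using eventually_at_right_less[of 0] by eventually_elim (rule b_le)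
qed auto

text \<open>Since \<open>F e 0\<close> tends to 0, both coefficients share one limit. It is
  \<open>B\<close> and not \<open>A\<close>: the missing mass A - B sits at the boundary.\<close>

lemma a_tendsto: "(a \<longlongrightarrow> B) (at_right 0)"
proof -
  have "((\<lambda>e. (F e 0 + b e * exp (- q * U e 0)) / exp (p * U e 0)) \<longlongrightarrow>
      (0 + B * exp (- q * 0)) / exp (p * 0)) (at_right 0)"
    using interior_null_tendsto[OF F_interior_null, of 0] R by (intro tendsto_intros U_0_tendsto b_tendsto) auto
  then show ?thesis by (simp add: F_def)
qed

text \<open>Only the weighted mass of \<open>F\<close> is known exactly; concentration replaces the
  weight by its value at \<open>R\<close>.\<close>

lemma F_int_tendsto: "((\<lambda>e. integral {0..R} (F e)) \<longlongrightarrow> R * (A - B) / real N) (at_right 0)"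
proof -
  have RN: "R ^ N = R * R ^ (N - 1)" using N by (cases N) (auto simp: One_nat_def)
  \<comment> \<open>The reciprocal of the weight at R/2, so that \<open>K * r ^ (N - 1)\<close> is
    at least 1 on the outer half. With F <= 1 on the inner half this gives the a priori mass bound
    that concentration requires.\<close>
  define K where "K = (2 / R) ^ (N - 1)"
  have K0: "0 < K" using R by (simp add: K_def)
  have "\<forall>\<^sub>F e in at_right 0. \<forall>r\<in>{0..R/2}. \<bar>F e r\<bar> \<le> 1"
    using R by (intro interior_nullD[OF F_interior_null]) auto
  then have "\<forall>\<^sub>F e in at_right 0. integral {0..R} (F e) \<le> R + K * (m * (A - B))"
    using eventually_at_right_less[of 0]
  proof eventually_elim
    case (elim e)
    have e: "0 < e" by fact
    have "F e r \<le> 1 + K * (r ^ (N - 1) * F e r)" if r: "r \<in> {0..R}" for r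
    proof (cases "r \<le> R / 2")
      case True
      have "0 \<le> K * (r ^ (N - 1) * F e r)"
        using K0 r F_nonneg[OF e r] by simp
      moreover have "\<bar>F e r\<bar> \<le> 1" using elim(1) True r by simp
      ultimately show ?thesis by linarith
    next
      case False
      then have "1 ^ (N - 1) \<le> (2 / R * r) ^ (N - 1)" using R by (intro power_mono) (auto simp: field_simps)
      then have "1 * F e r \<le> (2 / R * r) ^ (N - 1) * F e r"
        using F_nonneg[OF e r] by (intro mult_right_mono) auto
      then show ?thesis unfolding power_mult_distrib by (simp add: K_def mult_ac)
    qed
    then have "integral {0..R} (F e) \<le> integral {0..R} (\<lambda>r. 1 + K * (r ^ (N - 1) * F e r))"
      using e by (intro integral_le integrable_continuous_real continuous_intros cont_e) auto
    also have "\<dots> = integral {0..R} (\<lambda>r. 1) + integral {0..R} (\<lambda>r. K * (r ^ (N - 1) * F e r))"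
      using e by (intro integral_add integrable_continuous_real continuous_intros cont_e) auto
    also have "\<dots> = R + K * (m * (A - B))" using R F_mean[OF e] by simp
    finally show ?case .
  qed
  then have *: "((\<lambda>e. integral {0..R} (\<lambda>r. r ^ (N - 1) * F e r) - R ^ (N - 1) * integral {0..R} (F e))
      \<longlongrightarrow> 0) (at_right 0)"
    by (intro interior_null_integral_concentrates[OF R F_interior_null] continuous_intros cont_e F_nonneg) auto
  have "((\<lambda>e. m * (A - B) / R ^ (N - 1) - (integral {0..R} (\<lambda>r. r ^ (N - 1) * F e r)
      - R ^ (N - 1) * integral {0..R} (F e)) / R ^ (N - 1))
      \<longlongrightarrow> m * (A - B) / R ^ (N - 1) - 0 / R ^ (N - 1)) (at_right 0)"
    using R by (intro tendsto_intros *) auto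
  then have "((\<lambda>e. m * (A - B) / R ^ (N - 1) - (integral {0..R} (\<lambda>r. r ^ (N - 1) * F e r)
      - R ^ (N - 1) * integral {0..R} (F e)) / R ^ (N - 1))
      \<longlongrightarrow> R * (A - B) / real N) (at_right 0)"
    using R by (simp add: m_def RN)
  then show ?thesis
  proof (rule Lim_transform_eventually)
    show "\<forall>\<^sub>F e in at_right 0. m * (A - B) / R ^ (N - 1) - (integral {0..R} (\<lambda>r. r ^ (N - 1) * F e r)
      - R ^ (N - 1) * integral {0..R} (F e)) / R ^ (N - 1) = integral {0..R} (F e)"
      using eventually_at_right_less[of 0]
      by eventually_elim (use R in \<open>simp add: F_mean diff_divide_distrib\<close>)
  qed
qed

lemma F_weak: "weak_dirac R F (R * (A - B) / real N)"
  by (intro weak_diracI R F_interior_null F_int_tendsto cont_e F_nonneg) auto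

section \<open>Limits of the two exponentials\<close>

lemma exp_interior_null: "interior_null R (\<lambda>e r. exp (c * U e r) - 1)"
  by (rule interior_null_isCont[OF U_interior_null, where \<phi>="\<lambda>x. exp (c * x) - 1"]) (auto intro!: continuous_intros)

lemma exp_neg_bound:
  "0 < e \<Longrightarrow> r \<in> {0..R} \<Longrightarrow> \<bar>exp (- q * U e r) - 1\<bar> \<le> exp (q / p * ln (A / B)) + 1"
  using exp_neg_U_le[of e r] exp_gt_zero[of "- q * U e r"] exp_gt_zero[of "q / p * ln (A / B)"]
  unfolding abs_le_iff by linarith

text \<open>The uniform bound \<open>exp_neg_bound\<close> prevents any mass at \<open>R\<close>, so
  interior convergence decides.\<close>

lemma exp_neg_Lconv0: "0 < \<theta> \<Longrightarrow> Lconv0 R \<theta> (\<lambda>e r. exp (- q * U e r) - 1)"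
proof (intro Lconv0_I interior_null_integral_tendsto_0[OF R])
  assume \<theta>: "0 < \<theta>"
  show "interior_null R (\<lambda>e r. \<bar>exp (- q * U e r) - 1\<bar> powr \<theta>)"
    using \<theta> by (intro interior_null_isCont[OF exp_interior_null, where \<phi>="\<lambda>x. \<bar>x\<bar> powr \<theta>"])
      (auto simp: isCont_def intro!: tendsto_eq_intros)
  show "(\<lambda>r. \<bar>exp (- q * U e r) - 1\<bar> powr \<theta>) integrable_on {0..R}" if "0 < e" for e
    using \<theta> that by (intro integrable_continuous_real continuous_on_powr' continuous_intros cont_e) auto
  show "\<forall>\<^sub>F e in at_right 0. \<forall>r\<in>{0..R}. \<bar>\<bar>exp (- q * U e r) - 1\<bar> powr \<theta>\<bar>
      \<le> (exp (q / p * ln (A / B)) + 1) powr \<theta>"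
    using eventually_at_right_less[of 0]
    by eventually_elim (use exp_neg_bound \<theta> in \<open>auto intro!: powr_mono2\<close>)
qed

lemma exp_neg_weak:
  assumes h: "continuous_on {0..R} h"
  shows "((\<lambda>e. integral {0..R} (\<lambda>r. h r * (exp (- q * U e r) - 1))) \<longlongrightarrow> 0) (at_right 0)"
proof -
  have "continuous_on {0..R} (\<lambda>r. \<bar>h r\<bar>)" using h by (intro continuous_intros)
  then have "\<exists>x\<in>{0..R}. \<forall>y\<in>{0..R}. \<bar>h y\<bar> \<le> \<bar>h x\<bar>"
    using R by (intro continuous_attains_sup) auto
  then obtain L where L: "\<And>r. r \<in> {0..R} \<Longrightarrow> \<bar>h r\<bar> \<le> L" by blast
  have L0: "0 \<le> L" using L[of R] R by auto
  show ?thesis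
  proof (rule interior_null_integral_tendsto_0[OF R])
    show "interior_null R (\<lambda>e r. h r * (exp (- q * U e r) - 1))"
      by (rule interior_null_mono[OF exp_interior_null[of "- q"], where C=L]) (auto simp: abs_mult intro!: mult_right_mono L)
    show "(\<lambda>r. h r * (exp (- q * U e r) - 1)) integrable_on {0..R}" if "0 < e" for e
      using that by (intro integrable_continuous_real continuous_intros cont_e h) auto
    show "\<forall>\<^sub>F e in at_right 0. \<forall>r\<in>{0..R}. \<bar>h r * (exp (- q * U e r) - 1)\<bar>
      \<le> L * (exp (q / p * ln (A / B)) + 1)"
      using eventually_at_right_less[of 0]
      by eventually_elim (use exp_neg_bound L L0 in \<open>auto simp only: abs_mult intro!: mult_mono\<close>)
  qed
qed

text \<open>As exp (p U) - 1 need not be nonnegative, \<open>weak_diracI\<close> does not apply.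
  Instead the definition of \<open>F\<close> is solved for it, a (exp (p U) - 1) = F + b (exp (- q
  U) - 1) + (b - a), and each term has a known limit.\<close>

lemma exp_pos_weak: "weak_dirac R (\<lambda>e r. exp (p * U e r) - 1) (R * (A - B) / (B * real N))"
  unfolding weak_dirac_def
proof (intro allI impI)
  fix h :: "real \<Rightarrow> real" assume h: "continuous_on {0..R} h"
  let ?Q = "\<lambda>e. integral {0..R} (\<lambda>r. h r * (exp (- q * U e r) - 1))"
  have F: "((\<lambda>e. integral {0..R} (\<lambda>r. h r * F e r)) \<longlongrightarrow> R * (A - B) / real N * h R) (at_right 0)"
    using F_weak h by (auto simp: weak_dirac_def)
  have "((\<lambda>e. (integral {0..R} (\<lambda>r. h r * F e r) + b e * ?Q e + (b e - a e) * integral {0..R} h) / a e)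
    \<longlongrightarrow> (R * (A - B) / real N * h R + B * 0 + (B - B) * integral {0..R} h) / B) (at_right 0)"
    using B by (intro tendsto_intros F exp_neg_weak h a_tendsto b_tendsto) auto
  then have "((\<lambda>e. (integral {0..R} (\<lambda>r. h r * F e r) + b e * ?Q e + (b e - a e) * integral {0..R} h) / a e)
    \<longlongrightarrow> R * (A - B) / (B * real N) * h R) (at_right 0)"
    by (simp add: mult_ac)
  then show "((\<lambda>e. integral {0..R} (\<lambda>r. h r * (exp (p * U e r) - 1)))
      \<longlongrightarrow> R * (A - B) / (B * real N) * h R) (at_right 0)"
  proof (rule Lim_transform_eventually)
    show "\<forall>\<^sub>F e in at_right 0. (integral {0..R} (\<lambda>r. h r * F e r) + b e * ?Q e
      + (b e - a e) * integral {0..R} h) / a e = integral {0..R} (\<lambda>r. h r * (exp (p * U e r) - 1))"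
      using eventually_at_right_less[of 0]
    proof eventually_elim
      case (elim e)
      have "integral {0..R} (\<lambda>r. h r * F e r) + b e * ?Q e + (b e - a e) * integral {0..R} h
        = integral {0..R} (\<lambda>r. h r * F e r) + integral {0..R} (\<lambda>r. b e * (h r * (exp (- q * U e r) - 1)))
          + integral {0..R} (\<lambda>r. (b e - a e) * h r)"
        by simp
      also have "\<dots> = integral {0..R} (\<lambda>r. h r * F e r + b e * (h r * (exp (- q * U e r) - 1)))
          + integral {0..R} (\<lambda>r. (b e - a e) * h r)"
        using elim by (subst integral_add) (auto intro!: integrable_continuous_real continuous_intros cont_e h)
      also have "\<dots> = integral {0..R} (\<lambda>r. h r * F e r + b e * (h r * (exp (- q * U e r) - 1))
          + (b e - a e) * h r)"
        using elim by (subst integral_add) (auto intro!: integrable_continuous_real continuous_intros cont_e h)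
      also have "\<dots> = integral {0..R} (\<lambda>r. a e * (h r * (exp (p * U e r) - 1)))"
        by (simp add: F_def algebra_simps)
      finally show ?case using a_pos[OF elim] by simp
    qed
  qed
qed

section \<open>Limit of the energy\<close>

lemma V_interior_null: "interior_null R V"
proof (rule interior_null_mono[where C="1 / (p * B)"])
  show "interior_null R (\<lambda>e r. (F e r)\<^sup>2)"
    by (rule interior_null_isCont[OF F_interior_null, where \<phi>="\<lambda>x. x\<^sup>2"]) auto
  show "\<bar>V e r\<bar> \<le> 1 / (p * B) * \<bar>(F e r)\<^sup>2\<bar>" if "0 < e" "r \<in> {0..R}" for e r
    using V_le[OF that] V_nonneg[OF that] by simp
qed

text \<open>\<open>V\<close> combines the two exponentials, whose limits are now known; tested
  against the constant 1, only exp (p U) contributes.\<close>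

lemma V_int_tendsto: "((\<lambda>e. integral {0..R} (V e)) \<longlongrightarrow> R * (A - B) / (p * real N)) (at_right 0)"
proof -
  let ?P = "\<lambda>e. integral {0..R} (\<lambda>r. exp (p * U e r) - 1)"
  let ?Q = "\<lambda>e. integral {0..R} (\<lambda>r. exp (- q * U e r) - 1)"
  have P: "(?P \<longlongrightarrow> R * (A - B) / (B * real N)) (at_right 0)"
    using exp_pos_weak[unfolded weak_dirac_def, rule_format, of "\<lambda>_. 1"] by simp
  have Q: "(?Q \<longlongrightarrow> 0) (at_right 0)"
    using exp_neg_weak[of "\<lambda>_. 1"] by simp
  have "((\<lambda>e. a e / p * (?P e + R * (1 - exp (p * U e 0))) + b e / q * (?Q e + R * (1 - exp (- q * U e 0))))
    \<longlongrightarrow> B / p * (R * (A - B) / (B * real N) + R * (1 - exp (p * 0))) + B / q * (0 + R * (1 - exp (- q * 0))))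
    (at_right 0)"
    using p q by (intro tendsto_intros P Q a_tendsto b_tendsto U_0_tendsto) auto
  then have "((\<lambda>e. a e / p * (?P e + R * (1 - exp (p * U e 0))) + b e / q * (?Q e + R * (1 - exp (- q * U e 0))))
    \<longlongrightarrow> R * (A - B) / (p * real N)) (at_right 0)"
    using B p by simp
  then show ?thesis
  proof (rule Lim_transform_eventually)
    show "\<forall>\<^sub>F e in at_right 0. a e / p * (?P e + R * (1 - exp (p * U e 0)))
      + b e / q * (?Q e + R * (1 - exp (- q * U e 0))) = integral {0..R} (V e)"
      using eventually_at_right_less[of 0]
    proof eventually_elim
      case (elim e)
      have E: "integral {0..R} (\<lambda>r. exp (c * U e r) - 1) + R * (1 - exp (c * U e 0))
        = integral {0..R} (\<lambda>r. exp (c * U e r) - exp (c * U e 0))" for c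
      proof -
        have "integral {0..R} (\<lambda>r. exp (c * U e r) - 1) + R * (1 - exp (c * U e 0))
          = integral {0..R} (\<lambda>r. exp (c * U e r) - 1) + integral {0..R} (\<lambda>r. 1 - exp (c * U e 0))"
          using R by simp
        also have "\<dots> = integral {0..R} (\<lambda>r. (exp (c * U e r) - 1) + (1 - exp (c * U e 0)))"
          using elim by (intro integral_add[symmetric] integrable_continuous_real continuous_intros cont_e) auto
        finally show ?thesis by simp
      qed
      have "integral {0..R} (V e) = integral {0..R} (\<lambda>r. a e / p * (exp (p * U e r) - exp (p * U e 0)))
        + integral {0..R} (\<lambda>r. b e / q * (exp (- q * U e r) - exp (- q * U e 0)))"
        unfolding V_def using elim p q
        by (intro integral_add integrable_continuous_real continuous_intros cont_e) auto
      then show ?case unfolding E by simp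
    qed
  qed
qed

lemma energy_bound: "\<exists>K>0. \<forall>e>0. \<forall>r\<in>{0..R}. (e * w e r)\<^sup>2 \<le> K * V e r"
proof -
  obtain c where c: "0 < c" "\<And>r. r \<in> {0..R} \<Longrightarrow> c \<le> g r" using g_ge by blast
  have "(e * w e r)\<^sup>2 \<le> 2 * M / c\<^sup>2 * V e r" if "0 < e" "r \<in> {0..R}" for e r
  proof -
    have "(e * w e r)\<^sup>2 * c\<^sup>2 \<le> (e * w e r)\<^sup>2 * (g r)\<^sup>2"
      using c(1) c(2)[OF that(2)] by (intro mult_left_mono power_mono) auto
    then have "(e * w e r)\<^sup>2 * c\<^sup>2 \<le> 2 * M * V e r" using energy_le[OF that] by linarith
    then show ?thesis using c(1) by (simp add: pos_le_divide_eq)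
  qed
  then show ?thesis using M c(1) by (intro exI[of _ "2 * M / c\<^sup>2"]) auto
qed

text \<open>The comparison of \<open>(G e r)\<^sup>2 / e\<^sup>2 / 2\<close> with
  \<open>k R * V e r\<close>, integrated, ties the total energy to the integral of \<open>V\<close>,
  whose limit is known.\<close>

lemma energy_weak: "weak_dirac R (\<lambda>e r. (e * w e r)\<^sup>2) (2 * R * (A - B) / (p * real N * g R))"
proof (rule weak_diracI[OF R])
  obtain K where K: "0 < K" "\<And>e r. 0 < e \<Longrightarrow> r \<in> {0..R} \<Longrightarrow> (e * w e r)\<^sup>2 \<le> K * V e r"
    using energy_bound by blast
  show in0: "interior_null R (\<lambda>e r. (e * w e r)\<^sup>2)"
    by (rule interior_null_mono[OF V_interior_null, where C=K]) (use K V_nonneg in auto)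
  show cont: "continuous_on {0..R} (\<lambda>r. (e * w e r)\<^sup>2)" if "0 < e" for e
    using that by (intro continuous_intros cont_e) auto
  have VC: "\<forall>\<^sub>F e in at_right 0. integral {0..R} (V e) \<le> R * (A - B) / (p * real N) + 1"
    using order_tendstoD(2)[OF V_int_tendsto, of "R * (A - B) / (p * real N) + 1"]
    by (auto elim: eventually_mono)
  define C where "C = R * (A - B) / (p * real N) + 1"
  have bd: "\<forall>\<^sub>F e in at_right 0. integral {0..R} (\<lambda>r. (e * w e r)\<^sup>2) \<le> K * C"
    using VC eventually_at_right_less[of 0]
  proof eventually_elim
    case (elim e)
    have "integral {0..R} (\<lambda>r. (e * w e r)\<^sup>2) \<le> integral {0..R} (\<lambda>r. K * V e r)"
      using K(2) elim(2) by (intro integral_le integrable_continuous_real continuous_intros cont_e continuous_on_V) auto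
    also have "\<dots> \<le> K * C" using elim(1) K(1) by (simp add: C_def)
    finally show ?case .
  qed
  have G_eq: "(G e r)\<^sup>2 / e\<^sup>2 / 2 = k r * g r / 2 * (e * w e r)\<^sup>2" if "0 < e" for e r
    using that by (simp add: G_def k_def power2_eq_square)
  have kg: "continuous_on {0..R} (\<lambda>r. k r * g r / 2)"
    by (intro continuous_intros continuous_on_k) auto
  \<comment> \<open>Concentration freezes the coefficient of the energy density at
    \<open>R\<close>.\<close>
  have 1: "((\<lambda>e. integral {0..R} (\<lambda>r. k r * g r / 2 * (e * w e r)\<^sup>2)
      - k R * g R / 2 * integral {0..R} (\<lambda>r. (e * w e r)\<^sup>2)) \<longlongrightarrow> 0) (at_right 0)"
    by (rule interior_null_integral_concentrates[OF R in0 kg cont _ bd]) auto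
  have kc: "continuous_on {0..R} (\<lambda>s. \<bar>k s - k R\<bar>)" using continuous_on_k by (intro continuous_intros)
  have 2: "((\<lambda>e. integral {0..R} (\<lambda>r. k r * g r / 2 * (e * w e r)\<^sup>2) - k R * integral {0..R} (V e)) \<longlongrightarrow> 0) (at_right 0)"
  proof (rule tendsto_zero_at_right_leI)
    fix \<eta> :: real assume \<eta>: "0 < \<eta>"
    obtain L where L: "\<And>r. r \<in> {0..R} \<Longrightarrow> \<bar>k r - k R\<bar> \<le> L"
      using continuous_attains_sup[OF _ _ kc] R by force
    have L0: "0 \<le> L" using L[of R] R by auto
    obtain d where d: "0 < d" "\<And>r. r \<in> {0..R} \<Longrightarrow> dist r R < d \<Longrightarrow> dist (k r) (k R) < \<eta>"
      using continuous_on_k \<eta> R unfolding continuous_on_iff by (metis atLeastAtMost_iff less_eq_real_def)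
    define c where "c = max (R/2) (R - d/2)"
    have c: "0 < c" "c < R" "R - c < d" using R d(1) by (auto simp: c_def)
    have near: "\<bar>k r - k R\<bar> \<le> \<eta>" if "r \<in> {c..R}" for r
      using d(2)[of r] that c by (auto simp: dist_real_def)
    \<comment> \<open>This choice makes \<open>L * V e c\<close> at most \<open>\<eta>\<close>;
      dividing by L + 1 also covers L = 0.\<close>
    have "0 < \<eta> / (L + 1)" using \<eta> L0 by simp
    from interior_nullD[OF V_interior_null c(1,2) this] VC eventually_at_right_less[of 0]
    show "\<forall>\<^sub>F e in at_right 0. \<bar>integral {0..R} (\<lambda>r. k r * g r / 2 * (e * w e r)\<^sup>2) - k R * integral {0..R} (V e)\<bar>
      \<le> (R + C) * \<eta>"
    proof eventually_elim
      case (elim e)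
      have Vc: "continuous_on {0..R} (V e)" by (rule continuous_on_V[OF elim(3)]) simp
      have fc: "continuous_on {0..R} (\<lambda>r. k r * g r / 2 * (e * w e r)\<^sup>2)"
        by (rule continuous_on_mult[OF kg cont[OF elim(3)]])
      have "V e c \<le> \<eta> / (L + 1)" using bspec[OF elim(1), of c] c by simp
      then have "L * V e c \<le> (L + 1) * (\<eta> / (L + 1))"
        using V_nonneg[of e c] elim c L0 by (intro mult_mono) auto
      then have LV: "L * V e c \<le> \<eta>" using L0 by simp
      have "integral {0..R} (\<lambda>r. k r * g r / 2 * (e * w e r)\<^sup>2) - k R * integral {0..R} (V e)
        = integral {0..R} (\<lambda>r. k r * g r / 2 * (e * w e r)\<^sup>2) - integral {0..R} (\<lambda>r. k R * V e r)"
        by simp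
      also have "\<dots> = integral {0..R} (\<lambda>r. k r * g r / 2 * (e * w e r)\<^sup>2 - k R * V e r)"
        by (intro integral_diff[symmetric] integrable_continuous_real fc continuous_on_mult
            continuous_on_const Vc)
      finally have eq: "integral {0..R} (\<lambda>r. k r * g r / 2 * (e * w e r)\<^sup>2) - k R * integral {0..R} (V e)
        = integral {0..R} (\<lambda>r. k r * g r / 2 * (e * w e r)\<^sup>2 - k R * V e r)" .
      have "norm (integral {0..R} (\<lambda>r. k r * g r / 2 * (e * w e r)\<^sup>2 - k R * V e r))
        \<le> integral {0..R} (\<lambda>r. \<eta> + \<eta> * V e r)"
      proof (rule integral_norm_bound_integral)
        show "norm (k r * g r / 2 * (e * w e r)\<^sup>2 - k R * V e r) \<le> \<eta> + \<eta> * V e r" if r: "r \<in> {0..R}" for r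
        proof -
          have "\<bar>(G e r)\<^sup>2 / e\<^sup>2 / 2 - k R * V e r\<bar> \<le> L * V e c + \<eta> * V e r"
            by (rule energy_near[OF elim(3) _ _ r L near]) (use c in auto)
          also have "\<dots> \<le> \<eta> + \<eta> * V e r" using LV by simp
          finally show ?thesis unfolding G_eq[OF elim(3)] real_norm_def .
        qed
        show "(\<lambda>r. k r * g r / 2 * (e * w e r)\<^sup>2 - k R * V e r) integrable_on {0..R}"
          by (intro integrable_continuous_real continuous_on_diff fc continuous_on_mult continuous_on_const Vc)
        show "(\<lambda>r. \<eta> + \<eta> * V e r) integrable_on {0..R}"
          by (intro integrable_continuous_real continuous_on_add continuous_on_mult continuous_on_const Vc)
      qed
      also have "\<dots> = integral {0..R} (\<lambda>r. \<eta>) + integral {0..R} (\<lambda>r. \<eta> * V e r)"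
        using elim by (intro integral_add integrable_continuous_real continuous_intros continuous_on_V) auto
      also have "\<dots> = R * \<eta> + \<eta> * integral {0..R} (V e)" using R by simp
      also have "\<dots> \<le> R * \<eta> + \<eta> * C" using elim(2) \<eta> by (simp add: C_def)
      finally show ?case unfolding eq real_norm_def by (simp only: distrib_right mult.commute[of \<eta>])
    qed
  qed
  have kR: "0 < k R" "0 < g R" using g_pos[of R] R by (auto simp: k_def)
  have lim: "((\<lambda>e. 2 / g R * integral {0..R} (V e) + (2 / (k R * g R)) *
     ((integral {0..R} (\<lambda>r. k r * g r / 2 * (e * w e r)\<^sup>2) - k R * integral {0..R} (V e))
      - (integral {0..R} (\<lambda>r. k r * g r / 2 * (e * w e r)\<^sup>2)
      - k R * g R / 2 * integral {0..R} (\<lambda>r. (e * w e r)\<^sup>2)))) \<longlongrightarrow>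
      2 / g R * (R * (A - B) / (p * real N)) + (2 / (k R * g R)) * (0 - 0)) (at_right 0)"
    by (intro tendsto_intros V_int_tendsto 1 2)
  \<comment> \<open>The weighted energy j cancels, so the plain energy i is 2 / g R times the
    integral of \<open>V\<close> plus a multiple of the two null differences.\<close>
  have eq1: "2 / g R * v + (2 / (k R * g R)) * ((j - k R * v) - (j - k R * g R / 2 * i)) = i" for v i j
  proof -
    have "(j - k R * v) - (j - k R * g R / 2 * i) = k R * g R / 2 * (i - 2 / g R * v)"
      using kR by (simp add: right_diff_distrib)
    moreover have "2 / (k R * g R) * (k R * g R / 2 * y) = y" for y using kR by simp
    ultimately show ?thesis by (simp only: add_diff_cancel_left' diff_add_cancel add_diff_eq add_diff_cancel_left')
  qed
  have eq2: "2 / g R * (R * (A - B) / (p * real N)) + (2 / (k R * g R)) * (0 - 0)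
      = 2 * R * (A - B) / (p * real N * g R)" by (simp add: mult.commute mult.left_commute)
  show "((\<lambda>e. integral {0..R} (\<lambda>r. (e * w e r)\<^sup>2)) \<longlongrightarrow>
      2 * R * (A - B) / (p * real N * g R)) (at_right 0)"
    using lim unfolding eq1 eq2 .
qed auto

section \<open>Rates\<close>

text \<open>\<open>V_R_le\<close> started at R/2, where \<open>V\<close> is small, shows that
  \<open>V e R\<close> is of order 1 / e^2, and \<open>exp_U_le\<close> carries this over. For e < 1
  the constants are absorbed into 1 / e^2.\<close>

lemma exp_U_R_le: "\<exists>K>0. \<forall>\<^sub>F e in at_right 0. exp (p * U e R) \<le> K / e\<^sup>2"
proof -
  obtain c where c: "0 < c" "\<And>r. r \<in> {0..R} \<Longrightarrow> c \<le> g r" using g_ge by blast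
  define K where "K = ((R / 2) ^ (N - 1))\<^sup>2 * c"
  have K: "0 < K" using R c by (simp add: K_def)
  have kK: "K \<le> k s" if "s \<in> {R/2..R}" for s
    unfolding K_def k_def using that R c(1) c(2)[of s] by (intro mult_mono power_mono) auto
  define c1 where "c1 = (m * (A - B))\<^sup>2 / (2 * K)"
  define c2 where "c2 = (A + p * B / q * exp (q / p * ln (A / B))) / B"
  have c12: "0 \<le> c1" "0 \<le> c2" using K A B p q by (auto simp: c1_def c2_def)
  have "\<forall>\<^sub>F e in at_right 0. \<forall>r\<in>{0..R/2}. \<bar>V e r\<bar> \<le> 1"
    using R by (intro interior_nullD[OF V_interior_null]) auto
  then have "\<forall>\<^sub>F e in at_right 0. exp (p * U e R) \<le> (p / B * (1 + c1) + c2) / e\<^sup>2"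
    using eventually_at_right_real[of 0 1, OF zero_less_one]
  proof eventually_elim
    case (elim e)
    then have e: "0 < e" "e < 1" by auto
    have e2: "1 \<le> 1 / e\<^sup>2" using e by (simp add: power_le_one)
    have "V e (R/2) \<le> 1" using bspec[OF elim(1), of "R/2"] R by simp
    then have "V e R \<le> 1 + c1 / e\<^sup>2"
      using V_R_le[OF e(1), of "R/2" K] R K kK by (simp add: c1_def)
    then have "p / B * V e R \<le> p / B * (1 / e\<^sup>2 + c1 / e\<^sup>2)"
      using p B e2 by (intro mult_left_mono) auto
    moreover have "exp (p * U e R) \<le> p / B * V e R + c2"
      using exp_U_le[OF e(1), of R] R by (simp add: c2_def)
    moreover have "c2 * 1 \<le> c2 * (1 / e\<^sup>2)" using e2 c12 by (intro mult_left_mono) auto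
    ultimately have "exp (p * U e R) \<le> p / B * (1 / e\<^sup>2 + c1 / e\<^sup>2) + c2 * (1 / e\<^sup>2)" by linarith
    then show ?case by (simp add: algebra_simps add_divide_distrib)
  qed
  moreover have "0 < p / B * (1 + c1) + c2" using c12 p B by (simp add: add_pos_nonneg)
  ultimately show ?thesis by blast
qed

lemma w_integral:
  assumes e: "0 < e" shows "integral {0..R} (w e) = U e R - U e 0"
  using R U_deriv[OF e] by (intro integral_unique fundamental_theorem_of_calculus)
    (auto simp flip: has_real_derivative_iff_has_vector_derivative)

lemma abs_w_powr_integrable:
  "0 < e \<Longrightarrow> 0 < \<theta> \<Longrightarrow> (\<lambda>r. \<bar>e * w e r\<bar> powr \<theta>) integrable_on {0..R}"
  by (intro integrable_continuous_real continuous_on_powr' continuous_intros cont_e) auto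

text \<open>As w >= 0, the \<open>L^1\<close> norm of e w is e (U R - U 0), and
  \<open>exp_U_R_le\<close> makes U R of order ln (1 / e) at most. \<open>powr_mean_le\<close>
  passes to the smaller exponents.\<close>

lemma rate_le_1:
  assumes \<theta>: "0 < \<theta>" "\<theta> \<le> 1"
  shows "\<exists>C>0. \<forall>\<^sub>F e in at_right 0. Lnorm R \<theta> (\<lambda>r. e * w e r) \<le> C * (e * ln (1 / e))"
proof -
  obtain K where K: "0 < K" "\<forall>\<^sub>F e in at_right 0. exp (p * U e R) \<le> K / e\<^sup>2"
    using exp_U_R_le by blast
  define C where "C = (\<bar>ln K\<bar> + 2) / p + 1"
  have C: "0 < C" using p by (simp add: C_def add_nonneg_pos)
  have "\<forall>\<^sub>F e in at_right 0. - 1 < U e 0"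
    using U_0_tendsto by (intro order_tendstoD(1)) auto
  \<comment> \<open>For e < exp (- 1) the logarithm l is at least 1, so ln K and - U 0 are absorbed
    into multiples of l.\<close>
  with K(2) eventually_at_right_real[of 0 "exp (- 1)", OF exp_gt_zero]
  have "\<forall>\<^sub>F e in at_right 0. Lnorm R \<theta> (\<lambda>r. e * w e r) \<le> (R + C) powr (1 / \<theta>) * (e * ln (1 / e))"
  proof eventually_elim
    case (elim e)
    then have e: "0 < e" "e < exp (- 1)" by auto
    define l where "l = ln (1 / e)"
    have "ln e < - 1" using e by (metis exp_gt_zero ln_exp ln_less_cancel_iff)
    then have l: "1 \<le> l" using e by (simp add: l_def ln_div)
    have "p * U e R \<le> ln (K / e\<^sup>2)" using elim(1) K(1) e
      by (subst exp_le_cancel_iff[symmetric]) simp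
    also have "\<dots> = ln K + 2 * l" using K(1) e by (simp add: l_def ln_div ln_realpow)
    also have "\<dots> \<le> \<bar>ln K\<bar> * l + 2 * l"
      using l mult_left_mono[of 1 l "\<bar>ln K\<bar>"] by linarith
    finally have "U e R \<le> (\<bar>ln K\<bar> * l + 2 * l) / p" using p by (simp add: pos_le_divide_eq mult.commute)
    then have "U e R - U e 0 \<le> (\<bar>ln K\<bar> * l + 2 * l) / p + l" using elim(3) l by linarith
    also have "\<dots> = C * l" by (simp add: C_def add_divide_distrib algebra_simps)
    finally have "e * integral {0..R} (w e) \<le> e * (C * l)"
      unfolding w_integral[OF e(1)] using e by (intro mult_left_mono) auto
    then have "integral {0..R} (\<lambda>r. e * w e r) \<le> C * (e * l)" by (simp add: mult_ac)
    then have "integral {0..R} (\<lambda>r. \<bar>e * w e r\<bar> powr \<theta>) \<le> (R + C) * (e * l) powr \<theta>"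
      using e l w_nonneg[OF e(1)] by (intro powr_mean_le R \<theta> continuous_intros cont_e) auto
    moreover have "0 \<le> e * l" using e l by simp
    ultimately show ?case using \<theta> R C abs_w_powr_integrable[OF e(1) \<theta>(1)]
      unfolding l_def by (intro Lnorm_le_powr) auto
  qed
  moreover have "0 < (R + C) powr (1 / \<theta>)" using R C by simp
  ultimately show ?thesis by blast
qed

text \<open>For \<open>\<theta> > 1\<close> the energy bound turns \<open>(e w)\<^sup>\<theta>\<close> into \<open>e\<close> times an exact derivative
  \<open>(exp (\<sigma> U))'\<close>, whose integral only sees the boundary value \<open>U R\<close>.\<close>

lemma rate_gt_1:
  assumes \<theta>: "1 < \<theta>" "\<theta> < 2"
  shows "\<exists>C>0. \<forall>\<^sub>F e in at_right 0. Lnorm R \<theta> (\<lambda>r. e * w e r) \<le> C * e powr (2 / \<theta> - 1)"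
proof -
  obtain K where K: "0 < K" "\<forall>\<^sub>F e in at_right 0. exp (p * U e R) \<le> K / e\<^sup>2"
    using exp_U_R_le by blast
  obtain L where L: "0 < L" "\<And>e r. 0 < e \<Longrightarrow> r \<in> {0..R} \<Longrightarrow> (e * w e r)\<^sup>2 \<le> L * V e r"
    using energy_bound by blast
  \<comment> \<open>Since (e w)^2 is at most a multiple of exp (p U), the power (e w)^(\<theta>-1)
    is at most a multiple of exp (\<sigma> U).\<close>
  define \<sigma> where "\<sigma> = p * (\<theta> - 1) / 2"
  have \<sigma>: "0 < \<sigma>" using p \<theta> by (simp add: \<sigma>_def)
  define H where "H = (L * A / p) powr ((\<theta> - 1) / 2)"
  have H: "0 < H" using L A p by (simp add: H_def)
  define C where "C = H * K powr ((\<theta> - 1) / 2) / \<sigma>"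
  have C: "0 < C" using H K \<sigma> by (simp add: C_def)
  from K(2) eventually_at_right_less[of 0]
  have "\<forall>\<^sub>F e in at_right 0. Lnorm R \<theta> (\<lambda>r. e * w e r) \<le> C powr (1 / \<theta>) * e powr (2 / \<theta> - 1)"
  proof eventually_elim
    case (elim e)
    have e: "0 < e" by fact
    have pt: "\<bar>e * w e r\<bar> powr \<theta> \<le> e * H * (exp (\<sigma> * U e r) * w e r)" if r: "r \<in> {0..R}" for r
    proof (cases "w e r = 0")
      case False
      define x where "x = e * w e r"
      have x: "0 < x" using False w_nonneg[OF e r] e by (simp add: x_def)
      have "exp (- q * U e r) \<le> exp (- q * U e 0)" using U_mono[OF e, of 0 r] r q by simp
      then have "b e / q * (exp (- q * U e r) - exp (- q * U e 0)) \<le> 0"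
        using b_pos[OF e] q by (intro mult_nonneg_nonpos) auto
      moreover have "a e / p * (exp (p * U e r) - exp (p * U e 0)) \<le> A / p * exp (p * U e r)"
        using a_le[OF e] a_pos[OF e] A p U_mono[OF e, of 0 r] r by (intro mult_mono divide_right_mono) auto
      ultimately have "V e r \<le> A / p * exp (p * U e r)" by (simp add: V_def)
      then have "L * V e r \<le> L * (A / p * exp (p * U e r))" using L(1) by (intro mult_left_mono) auto
      then have "x\<^sup>2 \<le> L * A / p * exp (p * U e r)"
        using L(2)[OF e r] by (simp add: x_def)
      then have "(x\<^sup>2) powr ((\<theta> - 1) / 2) \<le> (L * A / p * exp (p * U e r)) powr ((\<theta> - 1) / 2)"
        using \<theta> by (intro powr_mono2) auto
      also have "\<dots> = H * exp (\<sigma> * U e r)"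
        unfolding H_def using L A p by (subst powr_mult) (auto simp: powr_def \<sigma>_def)
      also have "(x\<^sup>2) powr ((\<theta> - 1) / 2) = x powr (\<theta> - 1)"
        using x by (rule power2_powr_half)
      finally have "x powr (\<theta> - 1) * x \<le> H * exp (\<sigma> * U e r) * x"
        using x by (intro mult_right_mono) auto
      moreover have "x powr \<theta> = x powr (\<theta> - 1) * x" using x by (simp add: powr_diff)
      ultimately have "\<bar>x\<bar> powr \<theta> \<le> H * exp (\<sigma> * U e r) * x" using x by simp
      then show ?thesis unfolding x_def by (simp add: mult_ac)
    qed simp
    have "((\<lambda>r. exp (\<sigma> * U e r) * w e r) has_integral exp (\<sigma> * U e R) / \<sigma> - exp (\<sigma> * U e 0) / \<sigma>) {0..R}"
    proof (rule fundamental_theorem_of_calculus)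
      fix r assume "r \<in> {0..R}"
      note D = U_deriv[OF e this]
      show "((\<lambda>r. exp (\<sigma> * U e r) / \<sigma>) has_vector_derivative exp (\<sigma> * U e r) * w e r) (at r within {0..R})"
        unfolding has_real_derivative_iff_has_vector_derivative[symmetric]
        using \<sigma> by (auto intro!: derivative_eq_intros D)
    qed (use R in auto)
    then have I: "integral {0..R} (\<lambda>r. exp (\<sigma> * U e r) * w e r) \<le> exp (\<sigma> * U e R) / \<sigma>"
      using \<sigma> by (simp add: integral_unique)
    have "exp (\<sigma> * U e R) = exp (p * U e R) powr ((\<theta> - 1) / 2)" by (simp add: powr_def \<sigma>_def)
    also have "\<dots> \<le> (K / e\<^sup>2) powr ((\<theta> - 1) / 2)" using elim(1) \<theta> by (intro powr_mono2) auto
    also have "\<dots> = K powr ((\<theta> - 1) / 2) / e powr (\<theta> - 1)"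
      using K e by (simp add: powr_divide power2_powr_half)
    finally have E: "exp (\<sigma> * U e R) \<le> K powr ((\<theta> - 1) / 2) / e powr (\<theta> - 1)" .
    have "integral {0..R} (\<lambda>r. \<bar>e * w e r\<bar> powr \<theta>)
        \<le> integral {0..R} (\<lambda>r. e * H * (exp (\<sigma> * U e r) * w e r))"
      using pt e \<theta> by (intro integral_le abs_w_powr_integrable integrable_continuous_real
          continuous_intros cont_e) auto
    also have "\<dots> = e * H * integral {0..R} (\<lambda>r. exp (\<sigma> * U e r) * w e r)" by simp
    also have "\<dots> \<le> e * H * (K powr ((\<theta> - 1) / 2) / e powr (\<theta> - 1) / \<sigma>)"
      using I divide_right_mono[OF E, of \<sigma>] \<sigma> e H by (intro mult_left_mono) auto
    also have "\<dots> = C * (e / e powr (\<theta> - 1))" by (simp add: C_def mult_ac)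
    also have "e / e powr (\<theta> - 1) = e powr (1 - (\<theta> - 1))" using e by (simp add: powr_diff power2_eq_square)
    \<comment> \<open>The exponent 2 - \<theta> is written so that the root of order \<theta> yields
      2 / \<theta> - 1.\<close>
    also have "1 - (\<theta> - 1) = (2 / \<theta> - 1) * \<theta>" using \<theta> by (simp add: field_simps)
    also have "e powr \<dots> = (e powr (2 / \<theta> - 1)) powr \<theta>" by (simp add: powr_powr)
    finally show ?case using \<theta> C e abs_w_powr_integrable[of e \<theta>] by (intro Lnorm_le_powr) auto
  qed
  moreover have "0 < C powr (1 / \<theta>)" using C by simp
  ultimately show ?thesis by blast
qed

lemma w_rate:
  assumes \<theta>: "\<theta> \<in> {0<..<2}"
  shows "\<exists>C>0. \<forall>\<^sub>F e in at_right 0. Lnorm R \<theta> (\<lambda>r. e * w e r)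
    \<le> C * e powr (min 1 (2 / \<theta> - 1)) * (if \<theta> \<le> 1 then ln (1 / e) else 1)"
proof (cases "\<theta> \<le> 1")
  case True
  then have m: "min 1 (2 / \<theta> - 1) = 1" using \<theta> by (auto simp: min_def field_simps)
  obtain C where C: "0 < C" "\<forall>\<^sub>F e in at_right 0. Lnorm R \<theta> (\<lambda>r. e * w e r) \<le> C * (e * ln (1 / e))"
    using rate_le_1[of \<theta>] \<theta> True by auto
  from C(2) eventually_at_right_less[of 0]
  have "\<forall>\<^sub>F e in at_right 0. Lnorm R \<theta> (\<lambda>r. e * w e r) \<le> C * e powr 1 * ln (1 / e)"
    by eventually_elim (simp add: mult.assoc)
  then show ?thesis using C(1) True by (auto simp: m)
next
  case False
  then have "min 1 (2 / \<theta> - 1) = 2 / \<theta> - 1" using \<theta> by (auto simp: min_def field_simps)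
  then show ?thesis using rate_gt_1[of \<theta>] \<theta> False by auto
qed

end

section \<open>Reduction of the problem (N*) to the case A > B\<close>

lemma has_real_derivative_unique_Icc:
  assumes "(f has_real_derivative y) (at x within {a..b})" "(f has_real_derivative z) (at x within {a..b})"
    and "a < b" "x \<in> {a..b}"
  shows "y = z"
  using vector_derivative_unique_within_closed_interval[of a b x f y z] assms
  by (simp add: has_real_derivative_iff_has_vector_derivative)

text \<open>The product rule: r^(N-1) times the left side of the equation is the derivative of the
  flux. \<open>w\<close> is taken from the C^1 condition and agrees with \<open>deriv U\<close>
  inside.\<close>

lemma solves_Nstar_radial:
  assumes sol: "solves_Nstar N R g A B p q e U" and g: "smooth_on {0..R} g"
    and g_pos: "\<forall>r\<in>{0..R}. g r > 0" and R: "0 < R" and N: "2 \<le> N"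
  shows "\<exists>w. radial_solution N R g A B p q e U w"
proof -
  obtain w where w: "\<And>r. r \<in> {0..R} \<Longrightarrow> (U has_real_derivative w r) (at r within {0..R})"
    "continuous_on {0..R} w"
    using sol unfolding solves_Nstar_def C1_on_def by blast
  have dU: "deriv U r = w r" if "r \<in> {0<..<R}" for r
    using w(1)[of r] that at_within_Icc_at[of 0 r R] by (auto intro: DERIV_imp_deriv)
  note w
  moreover have "w 0 = 0" "w R = R * (A - B) / (e\<^sup>2 * real N * g R)"
    using sol R w(1)[of 0] w(1)[of R] unfolding solves_Nstar_def
    by (auto intro: has_real_derivative_unique_Icc)
  moreover have "((\<lambda>r. e\<^sup>2 * (r ^ (N - 1) * g r * w r)) has_real_derivative
        r ^ (N - 1) * (R ^ N / real N *
          (A * exp (p * U r) / integral {0..R} (\<lambda>s. s ^ (N - 1) * exp (p * U s))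
           - B * exp (- q * U r) / integral {0..R} (\<lambda>s. s ^ (N - 1) * exp (- q * U s))))) (at r)"
    (is "(_ has_real_derivative r ^ (N - 1) * ?F) _") if r: "r \<in> {0<..<R}" for r
  proof -
    obtain D where D: "D 0 = U" "\<And>n x. x \<in> {0<..<R} \<Longrightarrow> (D n has_real_derivative D (Suc n) x) (at x within {0<..<R})"
      using sol unfolding solves_Nstar_def smooth_on_def by blast
    have D': "(D n has_real_derivative D (Suc n) x) (at x)" if "x \<in> {0<..<R}" for n x
      using D(2)[OF that, of n] that by (simp add: at_within_open[OF that])
    have D1: "D 1 x = w x" if "x \<in> {0<..<R}" for x
      using D'[OF that, of 0] dU[OF that] D(1) by (metis DERIV_imp_deriv One_nat_def)
    have ev: "\<forall>\<^sub>F x in nhds r. x \<in> {0<..<R}"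
      using r by (intro eventually_nhds_in_open) auto
    \<comment> \<open>\<open>w\<close> is only known to be continuous; it coincides near
      \<open>r\<close> with the first derivative \<open>D 1\<close> from smoothness and so inherits
      its derivative.\<close>
    have dw: "(w has_real_derivative D 2 r) (at r)"
    proof -
      have "\<forall>\<^sub>F x in nhds r. D 1 x = w x" using ev by eventually_elim (rule D1)
      then show ?thesis
        using D'[OF r, of 1] DERIV_cong_ev[of r r "D 1" w "D 2 r" "D 2 r"] by (simp add: numeral_2_eq_2 One_nat_def)
    qed
    have "\<forall>\<^sub>F x in nhds r. deriv U x = w x" using ev by eventually_elim (rule dU)
    then have "(deriv U has_real_derivative D 2 r) (at r)"
      using dw DERIV_cong_ev[of r r "deriv U" w "D 2 r" "D 2 r"] by auto
    then have ddU: "deriv (deriv U) r = D 2 r" by (rule DERIV_imp_deriv)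
    obtain d where d: "(g has_real_derivative d) (at r within {0..R})"
      using g r unfolding smooth_on_def by force
    then have dg: "(g has_real_derivative d) (at r)" using r at_within_Icc_at[of 0 r R] by simp
    then have ddg: "deriv g r = d" by (rule DERIV_imp_deriv)
    have ode: "e\<^sup>2 * g r * (D 2 r + ((real N - 1) / r + d / g r) * w r) = ?F"
      using sol r dU[OF r] ddU ddg unfolding solves_Nstar_def by force
    have "((\<lambda>r. e\<^sup>2 * (r ^ (N - 1) * g r * w r)) has_real_derivative
      e\<^sup>2 * (r ^ (N - 1) * g r * D 2 r + (r ^ (N - 1) * d + real (N - 1) * r ^ (N - 1 - 1) * g r) * w r)) (at r)"
      by (auto intro!: derivative_eq_intros dg dw)
    moreover have "e\<^sup>2 * (r ^ (N - 1) * g r * D 2 r + (r ^ (N - 1) * d + real (N - 1) * r ^ (N - 1 - 1) * g r) * w r)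
      = r ^ (N - 1) * ?F"
    proof -
      \<comment> \<open>N >= 2 makes N - 1 - 1 a genuine difference, so the power is r^(N-1) /
        r.\<close>
      have 1: "real (N - 1) * r ^ (N - 1 - 1) = r ^ (N - 1) * ((real N - 1) / r)"
      proof -
        obtain n where "N = Suc (Suc n)" using N by (metis Suc_le_D numeral_2_eq_2 Suc_le_mono)
        then show ?thesis using r by (simp add: One_nat_def)
      qed
      have gr: "g r \<noteq> 0" using bspec[OF g_pos, of r] r by auto
      have "g r * (D 2 r + ((real N - 1) / r + d / g r) * w r)
        = g r * D 2 r + (d + ((real N - 1) / r) * g r) * w r"
        using gr by (simp add: distrib_left distrib_right)
      then have "e\<^sup>2 * g r * (D 2 r + ((real N - 1) / r + d / g r) * w r)
        = e\<^sup>2 * (g r * D 2 r + (d + ((real N - 1) / r) * g r) * w r)"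
        by (simp only: mult.assoc)
      then show ?thesis unfolding 1 ode[symmetric] by (simp only:) (simp add: algebra_simps)
    qed
    ultimately show ?thesis by simp
  qed
  moreover have "integral {0..R} (\<lambda>s. s ^ (N - 1) * U s) = 0"
    using sol by (simp add: solves_Nstar_def)
  ultimately show ?thesis using w unfolding radial_solution_def by blast
qed

text \<open>Negating \<open>U\<close> exchanges the two exponential terms and reverses the flux and
  the boundary data, so B < A may be assumed without loss of generality.\<close>

lemma radial_solution_uminus:
  "radial_solution N R g A B p q e U w \<Longrightarrow>
    radial_solution N R g B A q p e (\<lambda>r. - U r) (\<lambda>r. - w r)"
  unfolding radial_solution_def
proof (elim conjE, intro conjI)
  assume "\<forall>r\<in>{0<..<R}. ((\<lambda>r. e\<^sup>2 * (r ^ (N - 1) * g r * w r)) has_real_derivative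
      r ^ (N - 1) * (R ^ N / real N *
        (A * exp (p * U r) / integral {0..R} (\<lambda>s. s ^ (N - 1) * exp (p * U s))
         - B * exp (- q * U r) / integral {0..R} (\<lambda>s. s ^ (N - 1) * exp (- q * U s))))) (at r)"
  then show "\<forall>r\<in>{0<..<R}. ((\<lambda>r. e\<^sup>2 * (r ^ (N - 1) * g r * - w r)) has_real_derivative
      r ^ (N - 1) * (R ^ N / real N *
        (B * exp (q * - U r) / integral {0..R} (\<lambda>s. s ^ (N - 1) * exp (q * - U s))
         - A * exp (- p * - U r) / integral {0..R} (\<lambda>s. s ^ (N - 1) * exp (- p * - U s))))) (at r)"
  proof (intro ballI, goal_cases)
    case (1 r)
    from DERIV_minus[OF bspec[OF this]] show ?case by (simp add: right_diff_distrib)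
  qed
next
  assume "\<forall>r\<in>{0..R}. (U has_real_derivative w r) (at r within {0..R})"
  then show "\<forall>r\<in>{0..R}. ((\<lambda>r. - U r) has_real_derivative - w r) (at r within {0..R})"
    by (auto intro: DERIV_minus)
next
  assume "w R = R * (A - B) / (e\<^sup>2 * real N * g R)"
  then show "- w R = R * (B - A) / (e\<^sup>2 * real N * g R)"
    by (simp add: minus_divide_left del: minus_divide_left[symmetric]) (simp add: algebra_simps)
qed (auto intro: continuous_on_minus)

theorem theorem4p1:
  fixes N :: nat and R A B p q :: real
    and g :: "real \<Rightarrow> real" and U :: "real \<Rightarrow> real \<Rightarrow> real"
  assumes N: "N \<ge> 2" and R: "R > 0"
    and g_smooth: "smooth_on {0..R} g" and g_pos: "\<forall>r\<in>{0..R}. g r > 0"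
    and A: "A > 0" and B: "B > 0" and p: "p > 0" and q: "q > 0" and AB: "A \<noteq> B"
    and sol: "\<forall>\<epsilon>>0. solves_Nstar N R g A B p q \<epsilon> (U \<epsilon>)"
  defines "\<rho> \<equiv> \<lambda>\<epsilon> r. - (R ^ N / real N) *
            (A * exp (p * U \<epsilon> r) / integral {0..R} (\<lambda>s. s ^ (N - 1) * exp (p * U \<epsilon> s))
             - B * exp (- q * U \<epsilon> r) / integral {0..R} (\<lambda>s. s ^ (N - 1) * exp (- q * U \<epsilon> s)))"
  shows "weak_dirac R \<rho> (R * (B - A) / real N)
    \<and> (A < B \<longrightarrow>
         weak_dirac R (\<lambda>\<epsilon> r. (\<epsilon> * deriv (U \<epsilon>) r)\<^sup>2) (2 * R * (B - A) / (q * real N * g R))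
       \<and> weak_dirac R (\<lambda>\<epsilon> r. exp (- q * U \<epsilon> r) - 1) (R * (B - A) / (A * real N))
       \<and> (\<forall>\<theta>>0. Lconv0 R \<theta> (\<lambda>\<epsilon> r. exp (p * U \<epsilon> r) - 1)))
    \<and> (A > B \<longrightarrow>
         weak_dirac R (\<lambda>\<epsilon> r. (\<epsilon> * deriv (U \<epsilon>) r)\<^sup>2) (2 * R * (A - B) / (p * real N * g R))
       \<and> weak_dirac R (\<lambda>\<epsilon> r. exp (p * U \<epsilon> r) - 1) (R * (A - B) / (B * real N))
       \<and> (\<forall>\<theta>>0. Lconv0 R \<theta> (\<lambda>\<epsilon> r. exp (- q * U \<epsilon> r) - 1)))
    \<and> (\<forall>\<theta>\<in>{0<..<2}.
         Lconv0 R \<theta> (\<lambda>\<epsilon> r. \<epsilon> * deriv (U \<epsilon>) r)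
       \<and> (\<exists>C>0. \<forall>\<^sub>F \<epsilon> in at_right 0.
            Lnorm R \<theta> (\<lambda>r. \<epsilon> * deriv (U \<epsilon>) r)
              \<le> C * \<epsilon> powr (min 1 (2 / \<theta> - 1)) * (if \<theta> \<le> 1 then ln (1 / \<epsilon>) else 1)))"
proof -
  have "\<forall>e. \<exists>w. 0 < e \<longrightarrow> radial_solution N R g A B p q e (U e) w"
    using solves_Nstar_radial[OF _ g_smooth g_pos R N] sol by blast
  then obtain w where w: "\<And>e. 0 < e \<Longrightarrow> radial_solution N R g A B p q e (U e) (w e)"
    by metis
  have deriv_U: "deriv (U e) r = w e r" if "0 < e" "r \<in> {0<..<R}" for e r
  proof -
    have "(U e has_real_derivative w e r) (at r within {0..R})"
      using w[OF that(1)] that(2) by (simp add: radial_solution_def)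
    then show ?thesis
      using that(2) at_within_Icc_at[of 0 r R] by (simp add: DERIV_imp_deriv)
  qed
  have g_cont: "continuous_on {0..R} g"
    using g_smooth unfolding smooth_on_def by (metis DERIV_continuous_on)
  then obtain M where M: "\<And>r. r \<in> {0..R} \<Longrightarrow> g r \<le> M"
    using continuous_attains_sup[OF _ _ g_cont] R by force
  let ?rate = "\<lambda>v \<theta>. \<exists>C>0. \<forall>\<^sub>F e in at_right 0. Lnorm R \<theta> (\<lambda>r. e * v e r)
    \<le> C * e powr (min 1 (2 / \<theta> - 1)) * (if \<theta> \<le> 1 then ln (1 / e) else 1)"
  \<comment> \<open>The norm only sees absolute values, so this serves both v = w and v = -
    w.\<close>
  have rate: "Lconv0 R \<theta> (\<lambda>e r. e * deriv (U e) r) \<and> ?rate (\<lambda>e. deriv (U e)) \<theta>"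
    if v: "?rate v \<theta>" "\<And>e r. \<bar>v e r\<bar> = \<bar>w e r\<bar>" and \<theta>: "\<theta> \<in> {0<..<2}" for v \<theta>
  proof -
    have eq: "Lnorm R \<theta> (\<lambda>r. e * deriv (U e) r) = Lnorm R \<theta> (\<lambda>r. e * v e r)" if "0 < e" for e
      using deriv_U[OF that] v(2) by (intro Lnorm_cong) (simp add: abs_mult)
    obtain C where C: "0 < C" "\<forall>\<^sub>F e in at_right 0. Lnorm R \<theta> (\<lambda>r. e * v e r)
      \<le> C * e powr (min 1 (2 / \<theta> - 1)) * (if \<theta> \<le> 1 then ln (1 / e) else 1)"
      using v(1) by blast
    from C(2) eventually_at_right_less[of 0]
    have "\<forall>\<^sub>F e in at_right 0. Lnorm R \<theta> (\<lambda>r. e * deriv (U e) r)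
      \<le> C * e powr (min 1 (2 / \<theta> - 1)) * (if \<theta> \<le> 1 then ln (1 / e) else 1)"
      by eventually_elim (simp only: eq)
    with Lconv0_of_rate[OF \<theta> this] C(1) show ?thesis by blast
  qed
  consider "B < A" | "A < B" using AB by linarith
  then show ?thesis
  proof cases
    case 1
    interpret radial_family N R A B p q M g U w
      using N R B 1 p q g_cont g_pos M w by unfold_locales auto
    have "weak_dirac R (\<lambda>e r. - F e r) (- (R * (A - B) / real N))"
      by (rule weak_dirac_uminus[OF F_weak])
    moreover have "(\<lambda>e r. - F e r) = \<rho>"
      by (intro ext) (simp add: F_def a_def b_def m_def \<rho>_def right_diff_distrib)
    moreover have "- (R * (A - B) / real N) = R * (B - A) / real N"
      by (simp add: right_diff_distrib diff_divide_distrib)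
    moreover have "weak_dirac R (\<lambda>e r. (e * deriv (U e) r)\<^sup>2) (2 * R * (A - B) / (p * real N * g R))"
      by (rule weak_dirac_cong[OF _ energy_weak]) (simp add: deriv_U)
    ultimately show ?thesis
      using 1 exp_pos_weak exp_neg_Lconv0 rate[OF w_rate] by simp
  next
    case 2
    interpret radial_family N R B A q p M g "\<lambda>e r. - U e r" "\<lambda>e r. - w e r"
      using N R A 2 p q g_cont g_pos M radial_solution_uminus[OF w] by unfold_locales auto
    \<comment> \<open>With the roles exchanged the nonlinearity of the locale is \<rho> itself,
      whereas in the first case it is - \<rho>.\<close>
    have "F = \<rho>"
      by (intro ext) (simp add: F_def a_def b_def m_def \<rho>_def right_diff_distrib)
    moreover have "weak_dirac R (\<lambda>e r. (e * deriv (U e) r)\<^sup>2) (2 * R * (B - A) / (q * real N * g R))"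
      by (rule weak_dirac_cong[OF _ energy_weak]) (simp add: deriv_U)
    ultimately show ?thesis
      using 2 F_weak exp_pos_weak exp_neg_Lconv0 rate[OF w_rate] by simp
  qed
qed

end
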